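(* Let $R$ be a unital commutative associative ring with $2\in R^\times$ and $S$ a quadratic étale $R$-algebra with canonical involution $\overline{\phantom{x}}$. Let $(P,h)$ and $(P',h')$ be two nondegenerate $\overline{\phantom{x}}$-hermitian spaces of rank three over $S$ with trivial determinant, and choose isomorphisms $\alpha:\bigwedge^3(P,h)\to\langle1\rangle$ and $\alpha':\bigwedge^3(P',h')\to\langle1\rangle$. Let $\varphi:(P,\alpha)\to(P',\alpha')$ be a morphism that is an isometry between $h$ and $h'$, i.e. $\varphi:P\to P'$ is an $S$-linear map with $\alpha'\circ\det(\varphi)=\alpha$ and $h'(\varphi(u),\varphi(v))=h(u,v)$ for all $u,v\in P$. Then: (i) $\varphi(u\times_\alpha v)=\varphi(u)\times_{\alpha'}\varphi(v)$ for all $u,v\in P$. (ii) $W(S,P,h,\alpha)\cong W(S,P',h',\alpha')$ via $\varphi$. (iii) ${\rm Col}(S,P,h,\alpha)\cong{\rm Col}(S,P',h',\alpha')$ via $G_\varphi((a,u))=(a,\varphi(u))$. (iv) ${\rm Cay}(S,P,h,\alpha)\cong{\rm Cay}(S,P',h',\alpha')$ via $H_\varphi((a,u))=(a,\varphi(u))$.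
   Context: A nondegenerate hermitian space $(P,h)$ of rank three over $S$ is a finitely generated projective $S$-module $P$ of constant rank three with a biadditive map $h:P\times P\to S$ that is $S$-linear in the first and conjugate-linear in the second variable, satisfies $h(w,w')=\overline{h(w',w)}$, and is such that $w\mapsto h(\cdot,w)$ is a conjugate-linear bijection $P\to{\rm Hom}_S(P,S)$. $\bigwedge^3(P,h)$ is $\bigwedge^3_S P$ with the hermitian form determined by $(u_1\wedge u_2\wedge u_3,v_1\wedge v_2\wedge v_3)\mapsto\det(h(u_i,v_j))$; $\langle1\rangle$ is $S$ with the form $(a,b)\mapsto a\bar b$. The space has trivial determinant if there is an isomorphism of hermitian spaces $\alpha:\bigwedge^3(P,h)\to\langle1\rangle$. Given $\alpha$, the cross product $\times_\alpha:P\times P\to P$ is defined by $h(u,v\times_\alpha w)=\alpha(u\wedge v\wedge w)$ for all $u,v,w\in P$. Here $\det(\varphi)=\bigwedge^3\varphi$. The associated $R$-algebras are: - $W(S,P,h,\alpha)=(P,\times_\alpha)$ (vector colour algebra); - ${\rm Col}(S,P,h,\alpha)=R\oplus P$ with $(a,u)(b,v)=(ab-\frac12(h(u,v)+\overline{h(u,v)}),\,va+ub+u\times_\alpha v)$ for $a,b\in R$, $u,v\in P$ (colour algebra); - ${\rm Cay}(S,P,h,\alpha)=S\oplus P$ with $(a,u)(b,v)=(ab-h(u,v),\,va+u\bar b+u\times_\alpha v)$ for $a,b\in S$, $u,v\in P$ (octonion algebra). Isomorphisms are isomorphisms of $R$-algebras. *)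

theory Defs
  imports "HOL-Algebra.Module" "HOL-Algebra.Ideal"
begin

section \<open>Modules\<close>

text \<open>Modules are records of type \<^typ>\<open>('a, 'b) module\<close>. This record type also has fields
  for a multiplication and a unit; the locale \<^locale>\<open>module\<close> does not look at them, and they are
  left unspecified below whenever the module at hand carries no product.\<close>

definition mod_hom ::
  "('a, 'k) ring_scheme \<Rightarrow> ('a, 'b, 'm) module_scheme \<Rightarrow> ('a, 'c, 'n) module_scheme \<Rightarrow> ('b \<Rightarrow> 'c) set"
  where
  "mod_hom R M N = {f \<in> carrier M \<rightarrow> carrier N.
     (\<forall>x\<in>carrier M. \<forall>y\<in>carrier M. f (x \<oplus>\<^bsub>M\<^esub> y) = f x \<oplus>\<^bsub>N\<^esub> f y) \<and>
     (\<forall>a\<in>carrier R. \<forall>x\<in>carrier M. f (a \<odot>\<^bsub>M\<^esub> x) = a \<odot>\<^bsub>N\<^esub> f x)}"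

definition mod_iso ::
  "('a, 'k) ring_scheme \<Rightarrow> ('a, 'b, 'm) module_scheme \<Rightarrow> ('a, 'c, 'n) module_scheme \<Rightarrow> ('b \<Rightarrow> 'c) set"
  where
  "mod_iso R M N = {f \<in> mod_hom R M N. bij_betw f (carrier M) (carrier N)}"

definition self_module :: "('a, 'k) ring_scheme \<Rightarrow> ('a, 'a) module" where
  "self_module R = \<lparr>carrier = carrier R, mult = mult R, one = one R, zero = zero R, add = add R,
     smult = mult R\<rparr>"

text \<open>Linear forms are made extensional, so that two of them are equal as HOL functions
  as soon as they agree on the carrier.\<close>

definition dual_carrier :: "('a, 'k) ring_scheme \<Rightarrow> ('a, 'b, 'm) module_scheme \<Rightarrow> ('b \<Rightarrow> 'a) set" where
  "dual_carrier R M = mod_hom R M (self_module R) \<inter> extensional (carrier M)"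

definition free_module :: "('a, 'k) ring_scheme \<Rightarrow> 'x set \<Rightarrow> ('a, 'x \<Rightarrow> 'a) module" where
  "free_module R X = \<lparr>
     carrier = {f. (\<forall>x\<in>X. f x \<in> carrier R) \<and> (\<forall>x. x \<notin> X \<longrightarrow> f x = \<zero>\<^bsub>R\<^esub>) \<and> finite {x. f x \<noteq> \<zero>\<^bsub>R\<^esub>}},
     mult = undefined, one = undefined,
     zero = (\<lambda>x. \<zero>\<^bsub>R\<^esub>),
     add = (\<lambda>f g x. f x \<oplus>\<^bsub>R\<^esub> g x),
     smult = (\<lambda>a f x. a \<otimes>\<^bsub>R\<^esub> f x)\<rparr>"

definition free_gen :: "('a, 'k) ring_scheme \<Rightarrow> 'x \<Rightarrow> 'x \<Rightarrow> 'a" where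
  "free_gen R x = (\<lambda>y. if y = x then \<one>\<^bsub>R\<^esub> else \<zero>\<^bsub>R\<^esub>)"

definition gen_submodule ::
  "('a, 'k) ring_scheme \<Rightarrow> ('a, 'b, 'm) module_scheme \<Rightarrow> 'b set \<Rightarrow> 'b set" where
  "gen_submodule R M X = \<Inter>{H. submodule H R M \<and> X \<subseteq> H}"

definition quot_module :: "('a, 'b, 'm) module_scheme \<Rightarrow> 'b set \<Rightarrow> ('a, 'b set) module" where
  "quot_module M K = \<lparr>
     carrier = a_rcosets\<^bsub>M\<^esub> K,
     mult = undefined, one = undefined,
     zero = K,
     add = (\<lambda>C D. C <+>\<^bsub>M\<^esub> D),
     smult = (\<lambda>a C. \<Union>x\<in>C. K +>\<^bsub>M\<^esub> (a \<odot>\<^bsub>M\<^esub> x))\<rparr>"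

section \<open>Finitely generated projective modules, rank and trace\<close>

text \<open>\<open>is_split R M n i p\<close> exhibits \<open>M\<close> as a direct summand of the free module of rank \<open>n\<close>.\<close>

definition is_split ::
  "('a, 'k) ring_scheme \<Rightarrow> ('a, 'b, 'm) module_scheme \<Rightarrow> nat \<Rightarrow> ('b \<Rightarrow> nat \<Rightarrow> 'a) \<Rightarrow> ((nat \<Rightarrow> 'a) \<Rightarrow> 'b) \<Rightarrow> bool"
  where
  "is_split R M n i p \<longleftrightarrow>
     i \<in> mod_hom R M (free_module R {..<n}) \<and>
     p \<in> mod_hom R (free_module R {..<n}) M \<and>
     (\<forall>x\<in>carrier M. p (i x) = x)"

definition fg_projective :: "('a, 'k) ring_scheme \<Rightarrow> ('a, 'b, 'm) module_scheme \<Rightarrow> bool" where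
  "fg_projective R M \<longleftrightarrow> module R M \<and> (\<exists>n i p. is_split R M n i p)"

definition loc_rel ::
  "('a, 'k) ring_scheme \<Rightarrow> 'a set \<Rightarrow> ('a, 'b, 'm) module_scheme \<Rightarrow> (('b \<times> 'a) \<times> ('b \<times> 'a)) set" where
  "loc_rel R T M = {((x, s), (y, t)). x \<in> carrier M \<and> s \<in> T \<and> y \<in> carrier M \<and> t \<in> T \<and>
     (\<exists>u\<in>T. u \<odot>\<^bsub>M\<^esub> (t \<odot>\<^bsub>M\<^esub> x) = u \<odot>\<^bsub>M\<^esub> (s \<odot>\<^bsub>M\<^esub> y))}"

definition frac ::
  "('a, 'k) ring_scheme \<Rightarrow> 'a set \<Rightarrow> ('a, 'b, 'm) module_scheme \<Rightarrow> 'b \<Rightarrow> 'a \<Rightarrow> ('b \<times> 'a) set" where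
  "frac R T M x s = loc_rel R T M `` {(x, s)}"

definition loc_ring :: "('a, 'k) ring_scheme \<Rightarrow> 'a set \<Rightarrow> ('a \<times> 'a) set ring" where
  "loc_ring R T = \<lparr>
     carrier = (carrier R \<times> T) // loc_rel R T (self_module R),
     mult = (\<lambda>A B. \<Union>(a, s)\<in>A. \<Union>(b, t)\<in>B. frac R T (self_module R) (a \<otimes>\<^bsub>R\<^esub> b) (s \<otimes>\<^bsub>R\<^esub> t)),
     one = frac R T (self_module R) \<one>\<^bsub>R\<^esub> \<one>\<^bsub>R\<^esub>,
     zero = frac R T (self_module R) \<zero>\<^bsub>R\<^esub> \<one>\<^bsub>R\<^esub>,
     add = (\<lambda>A B. \<Union>(a, s)\<in>A. \<Union>(b, t)\<in>B.
       frac R T (self_module R) (t \<otimes>\<^bsub>R\<^esub> a \<oplus>\<^bsub>R\<^esub> s \<otimes>\<^bsub>R\<^esub> b) (s \<otimes>\<^bsub>R\<^esub> t))\<rparr>"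

definition loc_module ::
  "('a, 'k) ring_scheme \<Rightarrow> 'a set \<Rightarrow> ('a, 'b, 'm) module_scheme \<Rightarrow> (('a \<times> 'a) set, ('b \<times> 'a) set) module"
  where
  "loc_module R T M = \<lparr>
     carrier = (carrier M \<times> T) // loc_rel R T M,
     mult = undefined, one = undefined,
     zero = frac R T M \<zero>\<^bsub>M\<^esub> \<one>\<^bsub>R\<^esub>,
     add = (\<lambda>A B. \<Union>(x, s)\<in>A. \<Union>(y, t)\<in>B.
       frac R T M (t \<odot>\<^bsub>M\<^esub> x \<oplus>\<^bsub>M\<^esub> s \<odot>\<^bsub>M\<^esub> y) (s \<otimes>\<^bsub>R\<^esub> t)),
     smult = (\<lambda>A B. \<Union>(a, s)\<in>A. \<Union>(y, t)\<in>B. frac R T M (a \<odot>\<^bsub>M\<^esub> y) (s \<otimes>\<^bsub>R\<^esub> t))\<rparr>"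

definition constant_rank :: "('a, 'k) ring_scheme \<Rightarrow> ('a, 'b, 'm) module_scheme \<Rightarrow> nat \<Rightarrow> bool" where
  "constant_rank R M n \<longleftrightarrow>
     (\<forall>q. primeideal q R \<longrightarrow>
        mod_iso (loc_ring R (carrier R - q)) (loc_module R (carrier R - q) M)
          (free_module (loc_ring R (carrier R - q)) {..<n}) \<noteq> {})"

text \<open>The trace of an endomorphism of a finitely generated projective module: the trace of the
  matrix of \<open>i \<circ> f \<circ> p\<close>, which does not depend on the chosen splitting.\<close>

definition endo_trace :: "('a, 'k) ring_scheme \<Rightarrow> ('a, 'b, 'm) module_scheme \<Rightarrow> ('b \<Rightarrow> 'b) \<Rightarrow> 'a" where
  "endo_trace R M f = (THE t. \<exists>n i p. is_split R M n i p \<and>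
     t = (\<Oplus>\<^bsub>R\<^esub>k\<in>{..<n}. i (f (p (free_gen R k))) k))"

section \<open>Quadratic etale algebras\<close>

definition alg_trace :: "('a, 'k) ring_scheme \<Rightarrow> ('a, 'b, 'm) module_scheme \<Rightarrow> 'b \<Rightarrow> 'a" where
  "alg_trace R S x = endo_trace R S (\<lambda>y. x \<otimes>\<^bsub>S\<^esub> y)"

text \<open>A commutative algebra that is finitely generated projective as a module is etale iff its
  trace form \<open>(x, y) \<mapsto> tr (x y)\<close> induces a bijection onto the dual module; as in Lenstra's
  account of finite etale algebras, this is taken as the definition.\<close>

definition quadratic_etale :: "('a, 'k) ring_scheme \<Rightarrow> ('a, 'b, 'm) module_scheme \<Rightarrow> bool" where
  "quadratic_etale R S \<longleftrightarrow>
     algebra R S \<and> fg_projective R S \<and> constant_rank R S 2 \<and>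
     bij_betw (\<lambda>x. \<lambda>y\<in>carrier S. alg_trace R S (x \<otimes>\<^bsub>S\<^esub> y)) (carrier S) (dual_carrier R S)"

text \<open>The canonical involution \<open>x \<mapsto> tr(x) 1 - x\<close>.\<close>

definition canon_invol :: "('a, 'k) ring_scheme \<Rightarrow> ('a, 'b, 'm) module_scheme \<Rightarrow> 'b \<Rightarrow> 'b" where
  "canon_invol R S x = alg_trace R S x \<odot>\<^bsub>S\<^esub> \<one>\<^bsub>S\<^esub> \<ominus>\<^bsub>S\<^esub> x"

section \<open>Hermitian spaces\<close>

definition hermitian_form ::
  "('a, 'k) ring_scheme \<Rightarrow> ('a, 'b, 'l) module_scheme \<Rightarrow> ('b, 'p, 'm) module_scheme \<Rightarrow>
   ('p \<Rightarrow> 'p \<Rightarrow> 'b) \<Rightarrow> bool" where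
  "hermitian_form R S P h \<longleftrightarrow>
     (\<forall>u\<in>carrier P. \<forall>v\<in>carrier P. h u v \<in> carrier S) \<and>
     (\<forall>u\<in>carrier P. \<forall>v\<in>carrier P. \<forall>w\<in>carrier P. h (u \<oplus>\<^bsub>P\<^esub> v) w = h u w \<oplus>\<^bsub>S\<^esub> h v w) \<and>
     (\<forall>u\<in>carrier P. \<forall>v\<in>carrier P. \<forall>w\<in>carrier P. h u (v \<oplus>\<^bsub>P\<^esub> w) = h u v \<oplus>\<^bsub>S\<^esub> h u w) \<and>
     (\<forall>s\<in>carrier S. \<forall>u\<in>carrier P. \<forall>v\<in>carrier P. h (s \<odot>\<^bsub>P\<^esub> u) v = s \<otimes>\<^bsub>S\<^esub> h u v) \<and>
     (\<forall>s\<in>carrier S. \<forall>u\<in>carrier P. \<forall>v\<in>carrier P. h u (s \<odot>\<^bsub>P\<^esub> v) = canon_invol R S s \<otimes>\<^bsub>S\<^esub> h u v) \<and>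
     (\<forall>u\<in>carrier P. \<forall>v\<in>carrier P. h u v = canon_invol R S (h v u))"

definition nondegenerate ::
  "('b, 'k) ring_scheme \<Rightarrow> ('b, 'p, 'm) module_scheme \<Rightarrow> ('p \<Rightarrow> 'p \<Rightarrow> 'b) \<Rightarrow> bool" where
  "nondegenerate S P h \<longleftrightarrow>
     bij_betw (\<lambda>w. \<lambda>u\<in>carrier P. h u w) (carrier P) (dual_carrier S P)"

definition hermitian_space3 ::
  "('a, 'k) ring_scheme \<Rightarrow> ('a, 'b, 'l) module_scheme \<Rightarrow> ('b, 'p, 'm) module_scheme \<Rightarrow>
   ('p \<Rightarrow> 'p \<Rightarrow> 'b) \<Rightarrow> bool" where
  "hermitian_space3 R S P h \<longleftrightarrow>
     fg_projective S P \<and> constant_rank S P 3 \<and> hermitian_form R S P h \<and> nondegenerate S P h"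

definition unit_form ::
  "('a, 'k) ring_scheme \<Rightarrow> ('a, 'b, 'l) module_scheme \<Rightarrow> 'b \<Rightarrow> 'b \<Rightarrow> 'b" where
  "unit_form R S a b = a \<otimes>\<^bsub>S\<^esub> canon_invol R S b"

definition hermitian_iso ::
  "('b, 'k) ring_scheme \<Rightarrow> ('b, 'p, 'm) module_scheme \<Rightarrow> ('p \<Rightarrow> 'p \<Rightarrow> 'b) \<Rightarrow>
   ('b, 'q, 'n) module_scheme \<Rightarrow> ('q \<Rightarrow> 'q \<Rightarrow> 'b) \<Rightarrow> ('p \<Rightarrow> 'q) set" where
  "hermitian_iso S P h Q k =
     {f \<in> mod_iso S P Q. \<forall>u\<in>carrier P. \<forall>v\<in>carrier P. k (f u) (f v) = h u v}"

section \<open>The third exterior power\<close>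

abbreviation triples :: "('b, 'p, 'm) module_scheme \<Rightarrow> ('p \<times> 'p \<times> 'p) set" where
  "triples P \<equiv> carrier P \<times> carrier P \<times> carrier P"

text \<open>The third exterior power is the free module on all triples modulo the submodule generated by
  the relations of an alternating trilinear map.\<close>

definition ext3_relators ::
  "('b, 'k) ring_scheme \<Rightarrow> ('b, 'p, 'm) module_scheme \<Rightarrow> ('p \<times> 'p \<times> 'p \<Rightarrow> 'b) set" where
  "ext3_relators S P =
     (let F = free_module S (triples P); g = (\<lambda>u v w. free_gen S (u, v, w)) in
       {g (u \<oplus>\<^bsub>P\<^esub> u') v w \<ominus>\<^bsub>F\<^esub> (g u v w \<oplus>\<^bsub>F\<^esub> g u' v w) | u u' v w.
          {u, u', v, w} \<subseteq> carrier P} \<union>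
       {g u (v \<oplus>\<^bsub>P\<^esub> v') w \<ominus>\<^bsub>F\<^esub> (g u v w \<oplus>\<^bsub>F\<^esub> g u v' w) | u v v' w.
          {u, v, v', w} \<subseteq> carrier P} \<union>
       {g u v (w \<oplus>\<^bsub>P\<^esub> w') \<ominus>\<^bsub>F\<^esub> (g u v w \<oplus>\<^bsub>F\<^esub> g u v w') | u v w w'.
          {u, v, w, w'} \<subseteq> carrier P} \<union>
       {g (s \<odot>\<^bsub>P\<^esub> u) v w \<ominus>\<^bsub>F\<^esub> s \<odot>\<^bsub>F\<^esub> g u v w | s u v w.
          s \<in> carrier S \<and> {u, v, w} \<subseteq> carrier P} \<union>
       {g u (s \<odot>\<^bsub>P\<^esub> v) w \<ominus>\<^bsub>F\<^esub> s \<odot>\<^bsub>F\<^esub> g u v w | s u v w.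
          s \<in> carrier S \<and> {u, v, w} \<subseteq> carrier P} \<union>
       {g u v (s \<odot>\<^bsub>P\<^esub> w) \<ominus>\<^bsub>F\<^esub> s \<odot>\<^bsub>F\<^esub> g u v w | s u v w.
          s \<in> carrier S \<and> {u, v, w} \<subseteq> carrier P} \<union>
       {g u v w | u v w. {u, v, w} \<subseteq> carrier P \<and> (u = v \<or> v = w \<or> u = w)})"

definition ext3_kernel ::
  "('b, 'k) ring_scheme \<Rightarrow> ('b, 'p, 'm) module_scheme \<Rightarrow> ('p \<times> 'p \<times> 'p \<Rightarrow> 'b) set" where
  "ext3_kernel S P = gen_submodule S (free_module S (triples P)) (ext3_relators S P)"

definition ext3 ::
  "('b, 'k) ring_scheme \<Rightarrow> ('b, 'p, 'm) module_scheme \<Rightarrow> ('b, ('p \<times> 'p \<times> 'p \<Rightarrow> 'b) set) module" where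
  "ext3 S P = quot_module (free_module S (triples P)) (ext3_kernel S P)"

definition wedge3 ::
  "('b, 'k) ring_scheme \<Rightarrow> ('b, 'p, 'm) module_scheme \<Rightarrow> 'p \<Rightarrow> 'p \<Rightarrow> 'p \<Rightarrow> ('p \<times> 'p \<times> 'p \<Rightarrow> 'b) set" where
  "wedge3 S P u v w = ext3_kernel S P +>\<^bsub>free_module S (triples P)\<^esub> free_gen S (u, v, w)"

text \<open>\<open>det(\<phi>)\<close>, the map induced by \<open>\<phi>\<close> on third exterior powers.\<close>

definition ext3_map ::
  "('b, 'k) ring_scheme \<Rightarrow> ('b, 'p, 'm) module_scheme \<Rightarrow> ('b, 'q, 'n) module_scheme \<Rightarrow> ('p \<Rightarrow> 'q) \<Rightarrow>
   ('p \<times> 'p \<times> 'p \<Rightarrow> 'b) set \<Rightarrow> ('q \<times> 'q \<times> 'q \<Rightarrow> 'b) set" where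
  "ext3_map S P Q \<phi> = (THE D. D \<in> mod_hom S (ext3 S P) (ext3 S Q) \<and>
     D \<in> extensional (carrier (ext3 S P)) \<and>
     (\<forall>u\<in>carrier P. \<forall>v\<in>carrier P. \<forall>w\<in>carrier P.
        D (wedge3 S P u v w) = wedge3 S Q (\<phi> u) (\<phi> v) (\<phi> w)))"

definition det3 :: "('b, 'k) ring_scheme \<Rightarrow> (nat \<Rightarrow> nat \<Rightarrow> 'b) \<Rightarrow> 'b" where
  "det3 S m =
     (m 0 0 \<otimes>\<^bsub>S\<^esub> m 1 1 \<otimes>\<^bsub>S\<^esub> m 2 2 \<oplus>\<^bsub>S\<^esub> m 0 1 \<otimes>\<^bsub>S\<^esub> m 1 2 \<otimes>\<^bsub>S\<^esub> m 2 0 \<oplus>\<^bsub>S\<^esub> m 0 2 \<otimes>\<^bsub>S\<^esub> m 1 0 \<otimes>\<^bsub>S\<^esub> m 2 1)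
     \<ominus>\<^bsub>S\<^esub> (m 0 2 \<otimes>\<^bsub>S\<^esub> m 1 1 \<otimes>\<^bsub>S\<^esub> m 2 0 \<oplus>\<^bsub>S\<^esub> m 0 1 \<otimes>\<^bsub>S\<^esub> m 1 0 \<otimes>\<^bsub>S\<^esub> m 2 2 \<oplus>\<^bsub>S\<^esub> m 0 0 \<otimes>\<^bsub>S\<^esub> m 1 2 \<otimes>\<^bsub>S\<^esub> m 2 1)"

text \<open>\<open>H\<close> is the hermitian form on the third exterior power determined by \<open>h\<close>. It exists because
  the determinant is alternating trilinear in the \<open>u\<^sub>i\<close> and, conjugate-linearly, in the \<open>v\<^sub>j\<close>;
  it is unique on the carrier because the decomposable elements generate.\<close>

definition ext3_form ::
  "('a, 'k) ring_scheme \<Rightarrow> ('a, 'b, 'l) module_scheme \<Rightarrow> ('b, 'p, 'm) module_scheme \<Rightarrow>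
   ('p \<Rightarrow> 'p \<Rightarrow> 'b) \<Rightarrow> (('p \<times> 'p \<times> 'p \<Rightarrow> 'b) set \<Rightarrow> ('p \<times> 'p \<times> 'p \<Rightarrow> 'b) set \<Rightarrow> 'b) \<Rightarrow> bool" where
  "ext3_form R S P h H \<longleftrightarrow>
     hermitian_form R S (ext3 S P) H \<and>
     (\<forall>u v. u ` {..<3} \<subseteq> carrier P \<longrightarrow> v ` {..<3} \<subseteq> carrier P \<longrightarrow>
        H (wedge3 S P (u 0) (u 1) (u 2)) (wedge3 S P (v 0) (v 1) (v (2::nat))) =
        det3 S (\<lambda>i j. h (u i) (v j)))"

definition det_trivialization ::
  "('a, 'k) ring_scheme \<Rightarrow> ('a, 'b, 'l) module_scheme \<Rightarrow> ('b, 'p, 'm) module_scheme \<Rightarrow>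
   ('p \<Rightarrow> 'p \<Rightarrow> 'b) \<Rightarrow> (('p \<times> 'p \<times> 'p \<Rightarrow> 'b) set \<Rightarrow> 'b) \<Rightarrow> bool" where
  "det_trivialization R S P h \<alpha> \<longleftrightarrow>
     (\<exists>H. ext3_form R S P h H \<and>
          \<alpha> \<in> hermitian_iso S (ext3 S P) H (self_module S) (unit_form R S))"

section \<open>The algebras\<close>

definition cross ::
  "('b, 'k) ring_scheme \<Rightarrow> ('b, 'p, 'm) module_scheme \<Rightarrow> ('p \<Rightarrow> 'p \<Rightarrow> 'b) \<Rightarrow>
   (('p \<times> 'p \<times> 'p \<Rightarrow> 'b) set \<Rightarrow> 'b) \<Rightarrow> 'p \<Rightarrow> 'p \<Rightarrow> 'p" where
  "cross S P h \<alpha> v w =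
     (THE x. x \<in> carrier P \<and> (\<forall>u\<in>carrier P. h u x = \<alpha> (wedge3 S P u v w)))"

text \<open>\<open>R\<close> acts on an \<open>S\<close>-module through the structure map \<open>r \<mapsto> r 1\<close> of \<open>S\<close>.\<close>

definition base_smult ::
  "('a, 'b, 'l) module_scheme \<Rightarrow> ('b, 'p, 'm) module_scheme \<Rightarrow> 'a \<Rightarrow> 'p \<Rightarrow> 'p" where
  "base_smult S P r u = (r \<odot>\<^bsub>S\<^esub> \<one>\<^bsub>S\<^esub>) \<odot>\<^bsub>P\<^esub> u"

text \<open>Nonassociative \<open>R\<close>-algebras are again module records, now with a meaningful product.
  The vector colour algebra has no unit, so its \<open>one\<close> field is left unspecified.\<close>

definition vector_colour_alg ::
  "('a, 'b, 'l) module_scheme \<Rightarrow> ('b, 'p, 'm) module_scheme \<Rightarrow> ('p \<Rightarrow> 'p \<Rightarrow> 'b) \<Rightarrow>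
   (('p \<times> 'p \<times> 'p \<Rightarrow> 'b) set \<Rightarrow> 'b) \<Rightarrow> ('a, 'p) module" where
  "vector_colour_alg S P h \<alpha> = \<lparr>
     carrier = carrier P,
     mult = cross S P h \<alpha>,
     one = undefined,
     zero = \<zero>\<^bsub>P\<^esub>,
     add = add P,
     smult = base_smult S P\<rparr>"

text \<open>The element \<open>1/2 (s + canon_invol s)\<close> of \<open>S\<close>, regarded as an element of \<open>R\<close>.\<close>

definition half_trace :: "('a, 'k) ring_scheme \<Rightarrow> ('a, 'b, 'l) module_scheme \<Rightarrow> 'b \<Rightarrow> 'a" where
  "half_trace R S s = (THE r. r \<in> carrier R \<and>
     r \<odot>\<^bsub>S\<^esub> \<one>\<^bsub>S\<^esub> = inv\<^bsub>R\<^esub> (\<one>\<^bsub>R\<^esub> \<oplus>\<^bsub>R\<^esub> \<one>\<^bsub>R\<^esub>) \<odot>\<^bsub>S\<^esub> (s \<oplus>\<^bsub>S\<^esub> canon_invol R S s))"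

definition colour_alg ::
  "('a, 'k) ring_scheme \<Rightarrow> ('a, 'b, 'l) module_scheme \<Rightarrow> ('b, 'p, 'm) module_scheme \<Rightarrow>
   ('p \<Rightarrow> 'p \<Rightarrow> 'b) \<Rightarrow> (('p \<times> 'p \<times> 'p \<Rightarrow> 'b) set \<Rightarrow> 'b) \<Rightarrow> ('a, 'a \<times> 'p) module" where
  "colour_alg R S P h \<alpha> = \<lparr>
     carrier = carrier R \<times> carrier P,
     mult = (\<lambda>(a, u) (b, v).
       (a \<otimes>\<^bsub>R\<^esub> b \<ominus>\<^bsub>R\<^esub> half_trace R S (h u v),
        base_smult S P a v \<oplus>\<^bsub>P\<^esub> base_smult S P b u \<oplus>\<^bsub>P\<^esub> cross S P h \<alpha> u v)),
     one = (\<one>\<^bsub>R\<^esub>, \<zero>\<^bsub>P\<^esub>),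
     zero = (\<zero>\<^bsub>R\<^esub>, \<zero>\<^bsub>P\<^esub>),
     add = (\<lambda>(a, u) (b, v). (a \<oplus>\<^bsub>R\<^esub> b, u \<oplus>\<^bsub>P\<^esub> v)),
     smult = (\<lambda>r (a, u). (r \<otimes>\<^bsub>R\<^esub> a, base_smult S P r u))\<rparr>"

definition octonion_alg ::
  "('a, 'k) ring_scheme \<Rightarrow> ('a, 'b, 'l) module_scheme \<Rightarrow> ('b, 'p, 'm) module_scheme \<Rightarrow>
   ('p \<Rightarrow> 'p \<Rightarrow> 'b) \<Rightarrow> (('p \<times> 'p \<times> 'p \<Rightarrow> 'b) set \<Rightarrow> 'b) \<Rightarrow> ('a, 'b \<times> 'p) module" where
  "octonion_alg R S P h \<alpha> = \<lparr>
     carrier = carrier S \<times> carrier P,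
     mult = (\<lambda>(a, u) (b, v).
       (a \<otimes>\<^bsub>S\<^esub> b \<ominus>\<^bsub>S\<^esub> h u v,
        a \<odot>\<^bsub>P\<^esub> v \<oplus>\<^bsub>P\<^esub> canon_invol R S b \<odot>\<^bsub>P\<^esub> u \<oplus>\<^bsub>P\<^esub> cross S P h \<alpha> u v)),
     one = (\<one>\<^bsub>S\<^esub>, \<zero>\<^bsub>P\<^esub>),
     zero = (\<zero>\<^bsub>S\<^esub>, \<zero>\<^bsub>P\<^esub>),
     add = (\<lambda>(a, u) (b, v). (a \<oplus>\<^bsub>S\<^esub> b, u \<oplus>\<^bsub>P\<^esub> v)),
     smult = (\<lambda>r (a, u). (r \<odot>\<^bsub>S\<^esub> a, base_smult S P r u))\<rparr>"

text \<open>Bijectivity makes such a map preserve a unit whenever there is one.\<close>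

definition alg_iso ::
  "('a, 'k) ring_scheme \<Rightarrow> ('a, 'b, 'm) module_scheme \<Rightarrow> ('a, 'c, 'n) module_scheme \<Rightarrow> ('b \<Rightarrow> 'c) set"
  where
  "alg_iso R A B = {f \<in> mod_iso R A B.
     \<forall>x\<in>carrier A. \<forall>y\<in>carrier A. f (x \<otimes>\<^bsub>A\<^esub> y) = f x \<otimes>\<^bsub>B\<^esub> f y}"

end

theory Submission
  imports Defs
begin

text \<open>Every operation of the three algebras is built from the module operations, the form and the cross
  product. An \<open>S\<close>-linear bijection that respects the form and the cross product is therefore an
  isomorphism of all of them, after adding an identity on the scalar component. The cross product
  is determined by \<open>h (w, u \<times> v) = \<alpha> (w \<and> u \<and> v)\<close>, and the hypotheses give
  \<open>h' (\<phi> w, \<phi> (u \<times> v)) = \<alpha> (w \<and> u \<and> v) = h' (\<phi> w, \<phi> u \<times> \<phi> v)\<close> for all \<open>w\<close>; hence \<open>\<phi>\<close> respects it as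
  soon as the vectors \<open>\<phi> w\<close> exhaust \<open>P'\<close> (\<open>map_cross\<close>). Everything rests on the bijectivity
  of \<open>\<phi>\<close>.

  Injectivity is immediate from nondegeneracy. For surjectivity, nondegeneracy of \<open>h\<close> splits each
  vector of \<open>P'\<close> into one in the image of \<open>\<phi>\<close> and one orthogonal to the image
  (\<open>image_carrier\<close>), so it must be shown that a vector \<open>q\<close> orthogonal to the image is zero
  (\<open>orthogonal_zero\<close>). Write \<open>H\<close> and \<open>H'\<close> for the forms on the third exterior powers. Since \<open>\<phi>\<close>
  preserves volumes, the induced map on exterior powers hits an element \<open>x\<close> of volume \<open>1\<close>. For
  \<open>b, c\<close> in \<open>P\<close> the product of \<open>x\<close> with \<open>q \<and> \<phi> b \<and> \<phi> c\<close> is a combination of Gram determinants with a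
  zero column; as \<open>H'\<close> is the form \<open>\<alpha>' x \<sqdot> invol (\<alpha>' y)\<close>, this makes \<open>q \<and> \<phi> b \<and> \<phi> c\<close> orthogonal
  to everything. Pairing it with \<open>q' \<and> \<phi> b' \<and> \<phi> c'\<close> shows that the scalar \<open>h' (q', q)\<close> kills all two
  by two Gram minors of \<open>h\<close> (\<open>orthogonal_annihilates_minors\<close>). It then kills the three by three
  Gram determinants, so all values of \<open>H\<close>, one of which is the conjugate of \<open>1\<close>. Multiplying by
  that value does not change \<open>h' (q', q)\<close>, which is itself a conjugate. Therefore
  \<open>h' (q', q) = 0\<close> for all \<open>q'\<close>, and \<open>q = 0\<close>.

  The preliminary sections establish that the third exterior power, a quotient of a free module, is
  a module with the expected universal property, and that the definite descriptions of
  \<open>ext3_map\<close> and of the cross product denote what they should.\<close>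

section \<open>Linear maps\<close>

lemma (in abelian_group) minus_zero_right: "x \<in> carrier G \<Longrightarrow> x \<ominus> \<zero> = x"
  using r_neg[OF zero_closed] by (simp add: a_minus_def)

lemma (in abelian_group) minus_eq_zeroD:
  assumes "x \<ominus> y = \<zero>" "x \<in> carrier G" "y \<in> carrier G"
  shows "x = y"
  using assms by (metis a_inv_closed a_minus_def minus_equality minus_minus)

lemma mod_homI:
  assumes "\<And>x. x \<in> carrier M \<Longrightarrow> f x \<in> carrier N"
    and "\<And>x y. x \<in> carrier M \<Longrightarrow> y \<in> carrier M \<Longrightarrow> f (x \<oplus>\<^bsub>M\<^esub> y) = f x \<oplus>\<^bsub>N\<^esub> f y"
    and "\<And>a x. a \<in> carrier R \<Longrightarrow> x \<in> carrier M \<Longrightarrow> f (a \<odot>\<^bsub>M\<^esub> x) = a \<odot>\<^bsub>N\<^esub> f x"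
  shows "f \<in> mod_hom R M N"
  using assms by (simp add: mod_hom_def)

lemma mod_homD:
  assumes "f \<in> mod_hom R M N"
  shows "x \<in> carrier M \<Longrightarrow> f x \<in> carrier N"
    and "x \<in> carrier M \<Longrightarrow> y \<in> carrier M \<Longrightarrow> f (x \<oplus>\<^bsub>M\<^esub> y) = f x \<oplus>\<^bsub>N\<^esub> f y"
    and "a \<in> carrier R \<Longrightarrow> x \<in> carrier M \<Longrightarrow> f (a \<odot>\<^bsub>M\<^esub> x) = a \<odot>\<^bsub>N\<^esub> f x"
  using assms by (auto simp: mod_hom_def)

lemma mod_hom_zero:
  assumes "module R M" "module R N" "f \<in> mod_hom R M N"
  shows "f \<zero>\<^bsub>M\<^esub> = \<zero>\<^bsub>N\<^esub>"
proof -
  interpret M: module R M by fact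
  interpret N: module R N by fact
  have "f \<zero>\<^bsub>M\<^esub> = f (\<zero>\<^bsub>R\<^esub> \<odot>\<^bsub>M\<^esub> \<zero>\<^bsub>M\<^esub>)" by simp
  also have "\<dots> = \<zero>\<^bsub>N\<^esub>"
    using mod_homD[OF assms(3)] by (simp del: M.smult_l_null M.smult_r_null)
  finally show ?thesis .
qed

lemma mod_hom_minus:
  assumes "module R M" "module R N" "f \<in> mod_hom R M N" "x \<in> carrier M" "y \<in> carrier M"
  shows "f (x \<ominus>\<^bsub>M\<^esub> y) = f x \<ominus>\<^bsub>N\<^esub> f y"
proof -
  interpret M: module R M by fact
  interpret N: module R N by fact
  note f = mod_homD[OF assms(3)]
  have "f (x \<ominus>\<^bsub>M\<^esub> y) \<oplus>\<^bsub>N\<^esub> f y = f x"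
    using assms(4,5) f(2)[of "x \<ominus>\<^bsub>M\<^esub> y" y] by (simp add: M.minus_eq M.a_assoc M.l_neg)
  then show ?thesis
    using assms(4,5) f(1) by (metis M.minus_closed N.add.inv_solve_right N.minus_eq)
qed

lemma mod_hom_comp:
  assumes "f \<in> mod_hom R L M" "g \<in> mod_hom R M N"
  shows "(\<lambda>x. g (f x)) \<in> mod_hom R L N"
  using assms by (auto simp: mod_hom_def Pi_iff)

lemma mod_hom_kernel_submodule:
  assumes "module R M" "module R N" "f \<in> mod_hom R M N"
  shows "submodule {x \<in> carrier M. f x = \<zero>\<^bsub>N\<^esub>} R M"
proof -
  interpret M: module R M by fact
  interpret N: module R N by fact
  note f = mod_homD[OF assms(3)] mod_hom_zero[OF assms]
  have "f (\<ominus>\<^bsub>M\<^esub> x) = \<zero>\<^bsub>N\<^esub>" if "x \<in> carrier M" "f x = \<zero>\<^bsub>N\<^esub>" for x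
    using f(2)[of x "\<ominus>\<^bsub>M\<^esub> x"] f(1)[of "\<ominus>\<^bsub>M\<^esub> x"] f(4) that by (simp add: M.r_neg)
  then show ?thesis
    using f by (intro M.submoduleI) auto
qed

lemma self_module_module:
  fixes R (structure)
  assumes "cring R"
  shows "module R (self_module R)"
proof -
  interpret cring R by fact
  show ?thesis
  proof (intro moduleI abelian_groupI, goal_cases)
    case (7 x)
    then show ?case by (auto simp: self_module_def intro!: bexI[of _ "\<ominus> x"] l_neg)
  qed (simp_all add: self_module_def a_assoc m_assoc l_distr r_distr a_comm a_lcomm is_cring)
qed

lemma self_module_simps:
  "carrier (self_module R) = carrier R" "add (self_module R) = add R"
  "smult (self_module R) = mult R" "zero (self_module R) = zero R"
  by (simp_all add: self_module_def)

section \<open>Free modules\<close>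

lemma free_module_module:
  fixes R (structure) and X :: "'x set"
  assumes "cring R"
  shows "module R (free_module R X)"
proof -
  interpret cring R by fact
  let ?F = "free_module R X"
  have supp_add: "finite {x. f x \<oplus> g x \<noteq> \<zero>}"
    if "finite {x. f x \<noteq> \<zero>}" "finite {x. g x \<noteq> \<zero>}" for f g :: "'x \<Rightarrow> 'a"
    by (rule finite_subset[OF _ finite_UnI[OF that]]) auto
  have supp_smult: "finite {x. a \<otimes> f x \<noteq> \<zero>}"
    if "finite {x. f x \<noteq> \<zero>}" "a \<in> carrier R" for f :: "'x \<Rightarrow> 'a" and a
    by (rule finite_subset[OF _ that(1)]) (use that in auto)
  have carrier: "f \<in> carrier ?F \<longleftrightarrow>
      (\<forall>x. f x \<in> carrier R) \<and> (\<forall>x. x \<notin> X \<longrightarrow> f x = \<zero>) \<and> finite {x. f x \<noteq> \<zero>}"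
    for f
    by (auto simp: free_module_def)
  show ?thesis
  proof (intro moduleI abelian_groupI, goal_cases)
    case (7 f)
    have "(\<lambda>x. \<ominus> f x) \<in> carrier ?F"
      using 7 by (auto simp: carrier elim: rev_finite_subset)
    moreover have "(\<lambda>x. \<ominus> f x) \<oplus>\<^bsub>?F\<^esub> f = \<zero>\<^bsub>?F\<^esub>"
      using 7 by (simp add: carrier) (simp add: free_module_def l_neg)
    ultimately show ?case by blast
  qed (unfold carrier, simp_all add: free_module_def is_cring supp_add supp_smult
         a_assoc a_comm a_lcomm m_assoc l_distr r_distr)
qed

lemma free_gen_closed:
  fixes R (structure)
  assumes "cring R" "x \<in> X"
  shows "free_gen R x \<in> carrier (free_module R X)"
proof -
  interpret cring R by fact
  have "finite {y. free_gen R x y \<noteq> \<zero>}"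
    by (rule finite_subset[of _ "{x}"]) (auto simp: free_gen_def)
  then show ?thesis using assms(2) by (auto simp: free_module_def free_gen_def)
qed

lemma free_module_induct [consumes 2, case_names zero add smult_gen]:
  fixes R (structure)
  assumes "cring R" "f \<in> carrier (free_module R X)"
    and "Q \<zero>\<^bsub>free_module R X\<^esub>"
    and "\<And>f g. f \<in> carrier (free_module R X) \<Longrightarrow> g \<in> carrier (free_module R X) \<Longrightarrow>
           Q f \<Longrightarrow> Q g \<Longrightarrow> Q (f \<oplus>\<^bsub>free_module R X\<^esub> g)"
    and "\<And>a x. a \<in> carrier R \<Longrightarrow> x \<in> X \<Longrightarrow> Q (a \<odot>\<^bsub>free_module R X\<^esub> free_gen R x)"
  shows "Q f"
proof -
  interpret cring R by fact
  let ?F = "free_module R X"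
  interpret F: module R ?F by (rule free_module_module) fact
  have "\<forall>f\<in>carrier ?F. {x. f x \<noteq> \<zero>} \<subseteq> A \<longrightarrow> Q f" if "finite A" for A
    using that
  proof induction
    case empty
    have "f = \<zero>\<^bsub>?F\<^esub>" if "{x. f x \<noteq> \<zero>} \<subseteq> {}" for f
      using that by (auto simp: free_module_def)
    with assms(3) show ?case by blast
  next
    case (insert x A)
    show ?case
    proof (intro ballI impI)
      fix f assume f: "f \<in> carrier ?F" and supp: "{y. f y \<noteq> \<zero>} \<subseteq> insert x A"
      \<comment> \<open>Split off the coefficient at \<open>x\<close>; the rest has support in \<open>A\<close>.\<close>
      let ?g = "f(x := \<zero>)"
      have g: "?g \<in> carrier ?F"
        using f by (auto simp: free_module_def elim: rev_finite_subset)
      have "{y. ?g y \<noteq> \<zero>} \<subseteq> A" using supp by auto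
      then have Qg: "Q ?g"
        using insert.IH g by blast
      show "Q f"
      proof (cases "x \<in> X")
        case True
        have val: "f y \<in> carrier R" for y
          using f by (cases "y \<in> X") (auto simp: free_module_def)
        have "f = ?g \<oplus>\<^bsub>?F\<^esub> f x \<odot>\<^bsub>?F\<^esub> free_gen R x"
          using val by (auto simp: free_module_def free_gen_def)
        moreover have "f x \<odot>\<^bsub>?F\<^esub> free_gen R x \<in> carrier ?F"
          using val free_gen_closed[OF assms(1) True] by simp
        ultimately show ?thesis
          using assms(4)[OF g _ Qg] assms(5)[OF val True] by metis
      next
        case False
        then have "?g = f" using f by (auto simp: free_module_def)
        with Qg show ?thesis by simp
      qed
    qed
  qed
  then show ?thesis
    using assms(2) by (fastforce simp: free_module_def)
qed

text \<open>The sum runs over the support of the finitely supported function \<open>f\<close>, that is, over a finite set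
  even when \<open>X\<close> is infinite; this is the linear map determined by \<open>g\<close> on generators.\<close>

definition linear_ext ::
  "('a, 'b, 'm) module_scheme \<Rightarrow> ('x \<Rightarrow> 'b) \<Rightarrow> ('a, 'k) ring_scheme \<Rightarrow> ('x \<Rightarrow> 'a) \<Rightarrow> 'b" where
  "linear_ext M g R f = (\<Oplus>\<^bsub>M\<^esub>x\<in>{x. f x \<noteq> \<zero>\<^bsub>R\<^esub>}. f x \<odot>\<^bsub>M\<^esub> g x)"

text \<open>The support of a sum may be smaller than the union of the supports, so the sums are first
  extended to a common finite index set on which the additional terms vanish.\<close>

lemma linear_ext_hom:
  assumes "module R M" and g: "\<And>x. x \<in> X \<Longrightarrow> g x \<in> carrier M"
  shows "linear_ext M g R \<in> mod_hom R (free_module R X) M"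
proof -
  interpret M: module R M by fact
  let ?F = "free_module R X" and ?L = "linear_ext M g R"
  interpret F: module R ?F by (rule free_module_module) (rule M.is_cring)
  have summand: "f x \<odot>\<^bsub>M\<^esub> g x \<in> carrier M" if "f \<in> carrier ?F" "x \<in> X" for f x
    using that g by (auto simp: free_module_def)
  \<comment> \<open>Terms outside the support contribute nothing, so any finite \<open>A\<close> between it and \<open>X\<close> may be used.\<close>
  have superset: "?L f = (\<Oplus>\<^bsub>M\<^esub>x\<in>A. f x \<odot>\<^bsub>M\<^esub> g x)"
    if f: "f \<in> carrier ?F" and A: "finite A" "A \<subseteq> X" "{x. f x \<noteq> \<zero>\<^bsub>R\<^esub>} \<subseteq> A" for f A
    unfolding linear_ext_def
    by (rule M.add.finprod_mono_neutral_cong_left) (use A g summand[OF f] in auto)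
  have supp: "finite {x. f x \<noteq> \<zero>\<^bsub>R\<^esub>}" "{x. f x \<noteq> \<zero>\<^bsub>R\<^esub>} \<subseteq> X" if "f \<in> carrier ?F" for f
    using that by (auto simp: free_module_def)
  show ?thesis
  proof (rule mod_homI)
    fix f assume f: "f \<in> carrier ?F"
    show "?L f \<in> carrier M"
      unfolding linear_ext_def using summand[OF f] supp(2)[OF f] by (intro M.finsum_closed) auto
  next
    fix f f' assume f: "f \<in> carrier ?F" and f': "f' \<in> carrier ?F"
    let ?A = "{x. f x \<noteq> \<zero>\<^bsub>R\<^esub>} \<union> {x. f' x \<noteq> \<zero>\<^bsub>R\<^esub>}"
    have A: "finite ?A" "?A \<subseteq> X" using supp[OF f] supp[OF f'] by auto
    have "{x. (f \<oplus>\<^bsub>?F\<^esub> f') x \<noteq> \<zero>\<^bsub>R\<^esub>} \<subseteq> ?A" by (auto simp: free_module_def)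
    then have "?L (f \<oplus>\<^bsub>?F\<^esub> f') = (\<Oplus>\<^bsub>M\<^esub>x\<in>?A. (f \<oplus>\<^bsub>?F\<^esub> f') x \<odot>\<^bsub>M\<^esub> g x)"
      using superset A f f' by simp
    also have "\<dots> = (\<Oplus>\<^bsub>M\<^esub>x\<in>?A. f x \<odot>\<^bsub>M\<^esub> g x \<oplus>\<^bsub>M\<^esub> f' x \<odot>\<^bsub>M\<^esub> g x)"
    proof (rule M.finsum_cong', goal_cases)
      case (3 x)
      then have "x \<in> X" using A by blast
      then show ?case using f f' g by (auto simp: free_module_def M.smult_l_distr)
    qed (use A summand[OF f] summand[OF f'] in auto)
    also have "\<dots> = ?L f \<oplus>\<^bsub>M\<^esub> ?L f'"
      using superset[OF f A] superset[OF f' A] A summand[OF f] summand[OF f']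
      by (subst M.finsum_addf) auto
    finally show "?L (f \<oplus>\<^bsub>?F\<^esub> f') = ?L f \<oplus>\<^bsub>M\<^esub> ?L f'" .
  next
    fix a f assume a: "a \<in> carrier R" and f: "f \<in> carrier ?F"
    let ?A = "{x. f x \<noteq> \<zero>\<^bsub>R\<^esub>}"
    have "{x. (a \<odot>\<^bsub>?F\<^esub> f) x \<noteq> \<zero>\<^bsub>R\<^esub>} \<subseteq> ?A" using a by (auto simp: free_module_def)
    then have "?L (a \<odot>\<^bsub>?F\<^esub> f) = (\<Oplus>\<^bsub>M\<^esub>x\<in>?A. (a \<odot>\<^bsub>?F\<^esub> f) x \<odot>\<^bsub>M\<^esub> g x)"
      using superset supp[OF f] a f by simp
    also have "\<dots> = (\<Oplus>\<^bsub>M\<^esub>x\<in>?A. a \<odot>\<^bsub>M\<^esub> (f x \<odot>\<^bsub>M\<^esub> g x))"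
    proof (rule M.finsum_cong', goal_cases)
      case (3 x)
      then have "x \<in> X" using supp[OF f] by blast
      then show ?case using a f g by (auto simp: free_module_def M.smult_assoc1)
    qed (use a supp[OF f] summand[OF f] in auto)
    also have "\<dots> = a \<odot>\<^bsub>M\<^esub> ?L f"
      unfolding linear_ext_def using a supp[OF f] summand[OF f]
      by (intro M.finsum_smult_ldistr[symmetric]) auto
    finally show "?L (a \<odot>\<^bsub>?F\<^esub> f) = a \<odot>\<^bsub>M\<^esub> ?L f" .
  qed
qed

lemma linear_ext_gen:
  assumes "module R M" "g x \<in> carrier M"
  shows "linear_ext M g R (free_gen R x) = g x"
proof -
  interpret M: module R M by fact
  show ?thesis
  proof (cases "\<one>\<^bsub>R\<^esub> = \<zero>\<^bsub>R\<^esub>")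
    case True
    \<comment> \<open>Over the zero ring the support of a generator is empty, but every module is zero.\<close>
    have "g x = \<zero>\<^bsub>M\<^esub>" using assms(2) M.smult_one M.smult_l_null True by metis
    moreover have "{y. free_gen R x y \<noteq> \<zero>\<^bsub>R\<^esub>} = {}" using True by (auto simp: free_gen_def)
    ultimately show ?thesis by (simp add: linear_ext_def)
  next
    case False
    then have "{y. free_gen R x y \<noteq> \<zero>\<^bsub>R\<^esub>} = {x}" by (auto simp: free_gen_def)
    then show ?thesis using assms(2) by (simp add: linear_ext_def free_gen_def)
  qed
qed

section \<open>Submodules and quotients\<close>

lemma gen_submodule_submodule:
  assumes "module R M" "X \<subseteq> carrier M"
  shows "submodule (gen_submodule R M X) R M"
proof -
  interpret M: module R M by fact
  show ?thesis
    unfolding gen_submodule_def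
  proof (rule M.submoduleI, goal_cases)
    case 1
    show ?case using M.carrier_is_submodule assms(2) by blast
  next
    case 2
    show ?case by (auto simp: submodule_def dest: subgroup.one_closed)
  qed (auto dest: M.submoduleE)
qed

lemma gen_submodule_superset: "X \<subseteq> gen_submodule R M X"
  by (auto simp: gen_submodule_def)

lemma gen_submodule_least: "submodule H R M \<Longrightarrow> X \<subseteq> H \<Longrightarrow> gen_submodule R M X \<subseteq> H"
  by (auto simp: gen_submodule_def)

lemma submodule_abelian_subgroup:
  assumes "module R M" "submodule K R M"
  shows "abelian_subgroup K M"
proof -
  interpret M: module R M by fact
  show ?thesis
    using assms(1) submodule.axioms(1)[OF assms(2)]
    by (intro abelian_subgroupI3 additive_subgroupI) (simp_all add: module_def)
qed

lemma quot_module_carrier: "carrier (quot_module M K) = {K +>\<^bsub>M\<^esub> x | x. x \<in> carrier M}"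
  by (auto simp: quot_module_def A_RCOSETS_def')

text \<open>Scaling a coset gives one coset and not merely a union of cosets: any two elements of the coset
  differ by an element of \<open>K\<close>, and \<open>K\<close> is stable under scalars.\<close>

lemma quot_module_simps:
  assumes "module R M" "submodule K R M" "x \<in> carrier M"
  shows "y \<in> carrier M \<Longrightarrow> (K +>\<^bsub>M\<^esub> x) \<oplus>\<^bsub>quot_module M K\<^esub> (K +>\<^bsub>M\<^esub> y) = K +>\<^bsub>M\<^esub> (x \<oplus>\<^bsub>M\<^esub> y)"
    and "a \<in> carrier R \<Longrightarrow> a \<odot>\<^bsub>quot_module M K\<^esub> (K +>\<^bsub>M\<^esub> x) = K +>\<^bsub>M\<^esub> (a \<odot>\<^bsub>M\<^esub> x)"
proof -
  interpret M: module R M by fact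
  interpret K: abelian_subgroup K M using assms(1,2) by (rule submodule_abelian_subgroup)
  show "(K +>\<^bsub>M\<^esub> x) \<oplus>\<^bsub>quot_module M K\<^esub> (K +>\<^bsub>M\<^esub> y) = K +>\<^bsub>M\<^esub> (x \<oplus>\<^bsub>M\<^esub> y)" if "y \<in> carrier M"
    using assms(3) that by (simp add: quot_module_def K.a_rcos_sum)
  assume a: "a \<in> carrier R"
  have "K +>\<^bsub>M\<^esub> (a \<odot>\<^bsub>M\<^esub> z) = K +>\<^bsub>M\<^esub> (a \<odot>\<^bsub>M\<^esub> x)" if z: "z \<in> K +>\<^bsub>M\<^esub> x" for z
  proof -
    obtain k where k: "k \<in> K" "z = k \<oplus>\<^bsub>M\<^esub> x" using z by (auto simp: a_r_coset_def')
    have "a \<odot>\<^bsub>M\<^esub> z = a \<odot>\<^bsub>M\<^esub> k \<oplus>\<^bsub>M\<^esub> a \<odot>\<^bsub>M\<^esub> x"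
      using k a assms(3) by (simp add: M.smult_r_distr)
    moreover have "a \<odot>\<^bsub>M\<^esub> k \<in> K" using M.submoduleE(4)[OF assms(2) a k(1)] .
    ultimately have "a \<odot>\<^bsub>M\<^esub> z \<in> K +>\<^bsub>M\<^esub> (a \<odot>\<^bsub>M\<^esub> x)" by (auto simp: a_r_coset_def')
    then show ?thesis
      using a assms(3) K.a_repr_independence' by (metis M.smult_closed)
  qed
  then have "(\<Union>z\<in>K +>\<^bsub>M\<^esub> x. K +>\<^bsub>M\<^esub> (a \<odot>\<^bsub>M\<^esub> z)) = K +>\<^bsub>M\<^esub> (a \<odot>\<^bsub>M\<^esub> x)"
    using K.a_rcos_self[OF assms(3)] by blast
  then show "a \<odot>\<^bsub>quot_module M K\<^esub> (K +>\<^bsub>M\<^esub> x) = K +>\<^bsub>M\<^esub> (a \<odot>\<^bsub>M\<^esub> x)"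
    by (simp add: quot_module_def)
qed

lemma quot_module_zero:
  assumes "module R M" "submodule K R M"
  shows "\<zero>\<^bsub>quot_module M K\<^esub> = K +>\<^bsub>M\<^esub> \<zero>\<^bsub>M\<^esub>"
proof -
  interpret M: module R M by fact
  show ?thesis
    using M.submoduleE(1)[OF assms(2)] by (simp add: quot_module_def)
qed

lemma quot_module_module:
  assumes "module R M" "submodule K R M"
  shows "module R (quot_module M K)"
proof -
  interpret M: module R M by fact
  note simps = quot_module_simps[OF assms] quot_module_zero[OF assms]
  show ?thesis
  proof (intro moduleI abelian_groupI, goal_cases)
    case (7 C)
    then obtain x where x: "x \<in> carrier M" "C = K +>\<^bsub>M\<^esub> x" by (auto simp: quot_module_carrier)
    have "(K +>\<^bsub>M\<^esub> (\<ominus>\<^bsub>M\<^esub> x)) \<oplus>\<^bsub>quot_module M K\<^esub> C = \<zero>\<^bsub>quot_module M K\<^esub>"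
      using x by (simp add: simps M.l_neg)
    then show ?case using x by (intro bexI) (auto simp: quot_module_carrier)
  qed (use M.is_cring in \<open>auto 0 3 simp: quot_module_carrier simps M.a_assoc M.a_comm M.a_lcomm
         M.smult_l_distr M.smult_r_distr M.smult_assoc1\<close>)
qed

lemma quot_module_proj_hom:
  assumes "module R M" "submodule K R M"
  shows "(\<lambda>x. K +>\<^bsub>M\<^esub> x) \<in> mod_hom R M (quot_module M K)"
  by (rule mod_homI) (auto simp: quot_module_carrier quot_module_simps[OF assms])

lemma quot_module_proj_eq_iff:
  assumes "module R M" "submodule K R M" "x \<in> carrier M" "y \<in> carrier M"
  shows "K +>\<^bsub>M\<^esub> x = K +>\<^bsub>M\<^esub> y \<longleftrightarrow> x \<ominus>\<^bsub>M\<^esub> y \<in> K"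
proof -
  interpret M: module R M by fact
  interpret K: abelian_subgroup K M using assms(1,2) by (rule submodule_abelian_subgroup)
  show ?thesis
    using assms(3,4) K.a_rcos_module[of y x] K.a_repr_independence'[of x y] K.a_rcos_self[of x]
    by (auto simp: M.minus_eq)
qed

text \<open>The extensionality of \<open>D\<close> makes it the only factorization of \<open>f\<close> as a HOL function, which is
  what a definite description of \<open>D\<close> requires.\<close>

lemma quot_module_factor:
  assumes "module R M" "module R N" "submodule K R M" "f \<in> mod_hom R M N"
    and "\<And>k. k \<in> K \<Longrightarrow> f k = \<zero>\<^bsub>N\<^esub>"
  obtains D where "D \<in> mod_hom R (quot_module M K) N"
    and "D \<in> extensional (carrier (quot_module M K))"
    and "\<And>x. x \<in> carrier M \<Longrightarrow> D (K +>\<^bsub>M\<^esub> x) = f x"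
proof -
  interpret M: module R M by fact
  interpret N: module R N by fact
  let ?Q = "quot_module M K"
  interpret Q: module R ?Q using assms(1,3) by (rule quot_module_module)
  note f = mod_homD[OF assms(4)]
  define D where "D = (\<lambda>C\<in>carrier ?Q. f (SOME x. x \<in> carrier M \<and> C = K +>\<^bsub>M\<^esub> x))"
  have D: "D (K +>\<^bsub>M\<^esub> x) = f x" if x: "x \<in> carrier M" for x
  proof -
    define y where "y = (SOME y. y \<in> carrier M \<and> K +>\<^bsub>M\<^esub> x = K +>\<^bsub>M\<^esub> y)"
    have y: "y \<in> carrier M" "K +>\<^bsub>M\<^esub> x = K +>\<^bsub>M\<^esub> y"
      using someI[of "\<lambda>y. y \<in> carrier M \<and> K +>\<^bsub>M\<^esub> x = K +>\<^bsub>M\<^esub> y" x] x by (auto simp: y_def)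
    have "f x \<ominus>\<^bsub>N\<^esub> f y = \<zero>\<^bsub>N\<^esub>"
      using assms(5) y x quot_module_proj_eq_iff[OF assms(1,3) x y(1)]
      by (simp flip: mod_hom_minus[OF assms(1,2,4)])
  then have "f x = f y"
      by (rule N.M.minus_eq_zeroD) (simp_all add: x y f(1))
    moreover have "D (K +>\<^bsub>M\<^esub> x) = f y"
      using x by (auto simp: D_def y_def quot_module_carrier)
    ultimately show ?thesis by simp
  qed
  have "D \<in> mod_hom R ?Q N"
    by (rule mod_homI) (auto simp: quot_module_carrier quot_module_simps[OF assms(1,3)] D f)
  moreover have "D \<in> extensional (carrier ?Q)" by (simp add: D_def)
  ultimately show ?thesis using that D by blast
qed

section \<open>The third exterior power\<close>

text \<open>Alternating trilinear maps, stated slot by slot through \<^const>\<open>mod_hom\<close>, so that composing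
  with linear maps needs no computation.\<close>

definition alternating3 ::
  "('b, 'k) ring_scheme \<Rightarrow> ('b, 'p, 'm) module_scheme \<Rightarrow> ('b, 'q, 'n) module_scheme \<Rightarrow>
   ('p \<Rightarrow> 'p \<Rightarrow> 'p \<Rightarrow> 'q) \<Rightarrow> bool" where
  "alternating3 S P M g \<longleftrightarrow>
     (\<forall>u\<in>carrier P. \<forall>v\<in>carrier P.
        (\<lambda>w. g w u v) \<in> mod_hom S P M \<and> (\<lambda>w. g u w v) \<in> mod_hom S P M \<and>
        (\<lambda>w. g u v w) \<in> mod_hom S P M \<and>
        g u u v = \<zero>\<^bsub>M\<^esub> \<and> g u v u = \<zero>\<^bsub>M\<^esub> \<and> g v u u = \<zero>\<^bsub>M\<^esub>)"

lemma alternating3_closed: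
  "alternating3 S P M g \<Longrightarrow> u \<in> carrier P \<Longrightarrow> v \<in> carrier P \<Longrightarrow> w \<in> carrier P \<Longrightarrow>
     g u v w \<in> carrier M"
  unfolding alternating3_def using mod_homD(1) by fast

lemma alternating3_comp:
  assumes "alternating3 S Q M g" "\<phi> \<in> mod_hom S P Q"
  shows "alternating3 S P M (\<lambda>u v w. g (\<phi> u) (\<phi> v) (\<phi> w))"
proof -
  note \<phi> = mod_homD(1)[OF assms(2)]
  have "(\<lambda>w. g (\<phi> w) (\<phi> u) (\<phi> v)) \<in> mod_hom S P M"
    "(\<lambda>w. g (\<phi> u) (\<phi> w) (\<phi> v)) \<in> mod_hom S P M"
    "(\<lambda>w. g (\<phi> u) (\<phi> v) (\<phi> w)) \<in> mod_hom S P M"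
    if "u \<in> carrier P" "v \<in> carrier P" for u v
    using assms(1) \<phi>[OF that(1)] \<phi>[OF that(2)]
    by (auto simp: alternating3_def intro: mod_hom_comp[OF assms(2)])
  then show ?thesis
    using assms(1) \<phi> by (simp add: alternating3_def)
qed

context
  fixes S :: "('b, 'k) ring_scheme" and P :: "('b, 'p, 'm) module_scheme"
  assumes P: "module S P"
begin

interpretation P: module S P by (rule P)

private abbreviation "F \<equiv> free_module S (triples P)"

interpretation F: module S F by (rule free_module_module) (rule P.is_cring)

lemma free_gen_triple_closed:
  "u \<in> carrier P \<Longrightarrow> v \<in> carrier P \<Longrightarrow> w \<in> carrier P \<Longrightarrow> free_gen S (u, v, w) \<in> carrier F"
  by (intro free_gen_closed P.is_cring) auto

text \<open>The generators of the relation submodule lie in a union of seven sets; the proofs of this and of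
  the next lemma point out the set to which each relation belongs.\<close>

lemma ext3_relators_add:
  assumes "{u, u', v, w} \<subseteq> carrier P"
  shows "free_gen S (u \<oplus>\<^bsub>P\<^esub> u', v, w) \<ominus>\<^bsub>F\<^esub>
      (free_gen S (u, v, w) \<oplus>\<^bsub>F\<^esub> free_gen S (u', v, w)) \<in> ext3_relators S P"
    and "free_gen S (v, u \<oplus>\<^bsub>P\<^esub> u', w) \<ominus>\<^bsub>F\<^esub>
      (free_gen S (v, u, w) \<oplus>\<^bsub>F\<^esub> free_gen S (v, u', w)) \<in> ext3_relators S P"
    and "free_gen S (v, w, u \<oplus>\<^bsub>P\<^esub> u') \<ominus>\<^bsub>F\<^esub>
      (free_gen S (v, w, u) \<oplus>\<^bsub>F\<^esub> free_gen S (v, w, u')) \<in> ext3_relators S P"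
  unfolding ext3_relators_def Let_def Un_iff mem_Collect_eq
  subgoal
    by (rule disjI1, rule disjI1, rule disjI1, rule disjI1, rule disjI1, rule disjI1,
        intro exI conjI, rule refl)
      (use assms in auto)
  subgoal
    by (rule disjI1, rule disjI1, rule disjI1, rule disjI1, rule disjI1, rule disjI2,
        intro exI conjI, rule refl)
      (use assms in auto)
  subgoal
    by (rule disjI1, rule disjI1, rule disjI1, rule disjI1, rule disjI2, intro exI conjI, rule refl)
      (use assms in auto)
  done

lemma ext3_relators_smult:
  assumes "s \<in> carrier S" "{u, v, w} \<subseteq> carrier P"
  shows "free_gen S (s \<odot>\<^bsub>P\<^esub> u, v, w) \<ominus>\<^bsub>F\<^esub>
      s \<odot>\<^bsub>F\<^esub> free_gen S (u, v, w) \<in> ext3_relators S P"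
    and "free_gen S (v, s \<odot>\<^bsub>P\<^esub> u, w) \<ominus>\<^bsub>F\<^esub>
      s \<odot>\<^bsub>F\<^esub> free_gen S (v, u, w) \<in> ext3_relators S P"
    and "free_gen S (v, w, s \<odot>\<^bsub>P\<^esub> u) \<ominus>\<^bsub>F\<^esub>
      s \<odot>\<^bsub>F\<^esub> free_gen S (v, w, u) \<in> ext3_relators S P"
  unfolding ext3_relators_def Let_def Un_iff mem_Collect_eq
  subgoal
    by (rule disjI1, rule disjI1, rule disjI1, rule disjI2, intro exI conjI, rule refl)
      (use assms in auto)
  subgoal
    by (rule disjI1, rule disjI1, rule disjI2, intro exI conjI, rule refl)
      (use assms in auto)
  subgoal
    by (rule disjI1, rule disjI2, intro exI conjI, rule refl)
      (use assms in auto)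
  done

lemma ext3_relators_degenerate:
  assumes "{u, v, w} \<subseteq> carrier P" "u = v \<or> v = w \<or> u = w"
  shows "free_gen S (u, v, w) \<in> ext3_relators S P"
  unfolding ext3_relators_def Let_def Un_iff mem_Collect_eq
  by (rule disjI2, intro exI conjI, rule refl)
      (use assms in auto)

lemma ext3_relators_closed: "ext3_relators S P \<subseteq> carrier F"
  unfolding ext3_relators_def Let_def by (auto simp: free_gen_triple_closed)

lemma ext3_kernel_submodule: "submodule (ext3_kernel S P) S F"
  unfolding ext3_kernel_def
  using F.module_axioms ext3_relators_closed by (rule gen_submodule_submodule)

lemma ext3_module: "module S (ext3 S P)"
  unfolding ext3_def using F.module_axioms ext3_kernel_submodule by (rule quot_module_module)

lemma wedge3_closed:
  "u \<in> carrier P \<Longrightarrow> v \<in> carrier P \<Longrightarrow> w \<in> carrier P \<Longrightarrow> wedge3 S P u v w \<in> carrier (ext3 S P)"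
  by (auto simp: ext3_def wedge3_def quot_module_carrier free_gen_triple_closed)

text \<open>Each relator says that two elements of the free module have the same class in the quotient, and
  the relators were chosen so that these equations are exactly the laws of an alternating trilinear
  map.\<close>

lemma wedge3_alternating: "alternating3 S P (ext3 S P) (wedge3 S P)"
proof -
  let ?g = "\<lambda>u v w. free_gen S (u, v, w)" and ?\<pi> = "\<lambda>f. ext3_kernel S P +>\<^bsub>F\<^esub> f"
  let ?E = "ext3 S P"
  note simps = quot_module_simps[OF F.module_axioms ext3_kernel_submodule, folded ext3_def]
  have relator_cong: "?\<pi> x = ?\<pi> y"
    if "x \<ominus>\<^bsub>F\<^esub> y \<in> ext3_relators S P" "x \<in> carrier F" "y \<in> carrier F" for x y
    using that gen_submodule_superset[of "ext3_relators S P" S F]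
      quot_module_proj_eq_iff[OF F.module_axioms ext3_kernel_submodule]
    by (auto simp: ext3_kernel_def)
  have sum: "?\<pi> x = ?\<pi> y \<oplus>\<^bsub>?E\<^esub> ?\<pi> z"
    if "x \<ominus>\<^bsub>F\<^esub> (y \<oplus>\<^bsub>F\<^esub> z) \<in> ext3_relators S P" "x \<in> carrier F" "y \<in> carrier F" "z \<in> carrier F"
    for x y z
    using relator_cong[OF that(1)] that by (simp add: simps)
  have scaled: "?\<pi> x = a \<odot>\<^bsub>?E\<^esub> ?\<pi> y"
    if "x \<ominus>\<^bsub>F\<^esub> a \<odot>\<^bsub>F\<^esub> y \<in> ext3_relators S P" "x \<in> carrier F" "y \<in> carrier F" "a \<in> carrier S"
    for x y a
    using relator_cong[OF that(1)] that by (simp add: simps)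
  have degenerate: "?\<pi> x = \<zero>\<^bsub>?E\<^esub>" if "x \<in> ext3_relators S P" "x \<in> carrier F" for x
  proof -
    have "x \<ominus>\<^bsub>F\<^esub> \<zero>\<^bsub>F\<^esub> = x"
      using that(2) by (rule F.M.minus_zero_right)
    with that(1) have "x \<ominus>\<^bsub>F\<^esub> \<zero>\<^bsub>F\<^esub> \<in> ext3_relators S P" by (simp only:)
    then have "?\<pi> x = ?\<pi> \<zero>\<^bsub>F\<^esub>"
      using that(2) F.M.zero_closed by (rule relator_cong)
    then show ?thesis
      by (simp add: ext3_def quot_module_zero[OF F.module_axioms ext3_kernel_submodule])
  qed
  show ?thesis
    unfolding alternating3_def wedge3_def
  proof (intro ballI conjI)
    fix u v assume uv: "u \<in> carrier P" "v \<in> carrier P"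
    note closed = uv free_gen_triple_closed
    show "(\<lambda>w. ?\<pi> (?g w u v)) \<in> mod_hom S P ?E"
      by (intro mod_homI sum scaled wedge3_closed[unfolded wedge3_def])
        (use closed ext3_relators_add ext3_relators_smult in auto)
    show "(\<lambda>w. ?\<pi> (?g u w v)) \<in> mod_hom S P ?E"
      by (intro mod_homI sum scaled wedge3_closed[unfolded wedge3_def])
        (use closed ext3_relators_add ext3_relators_smult in auto)
    show "(\<lambda>w. ?\<pi> (?g u v w)) \<in> mod_hom S P ?E"
      by (intro mod_homI sum scaled wedge3_closed[unfolded wedge3_def])
        (use closed ext3_relators_add ext3_relators_smult in auto)
    show "?\<pi> (?g u u v) = \<zero>\<^bsub>?E\<^esub>" "?\<pi> (?g u v u) = \<zero>\<^bsub>?E\<^esub>" "?\<pi> (?g v u u) = \<zero>\<^bsub>?E\<^esub>"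
      using closed ext3_relators_degenerate by (auto intro!: degenerate)
  qed
qed

text \<open>The decomposable elements span the third exterior power because the generators span the free
  module.\<close>

lemma ext3_induct [consumes 1, case_names zero add smult wedge]:
  assumes "y \<in> carrier (ext3 S P)"
    and "Q \<zero>\<^bsub>ext3 S P\<^esub>"
    and "\<And>x y. x \<in> carrier (ext3 S P) \<Longrightarrow> y \<in> carrier (ext3 S P) \<Longrightarrow> Q x \<Longrightarrow> Q y \<Longrightarrow>
           Q (x \<oplus>\<^bsub>ext3 S P\<^esub> y)"
    and "\<And>a x. a \<in> carrier S \<Longrightarrow> x \<in> carrier (ext3 S P) \<Longrightarrow> Q x \<Longrightarrow> Q (a \<odot>\<^bsub>ext3 S P\<^esub> x)"
    and "\<And>u v w. u \<in> carrier P \<Longrightarrow> v \<in> carrier P \<Longrightarrow> w \<in> carrier P \<Longrightarrow> Q (wedge3 S P u v w)"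
  shows "Q y"
proof -
  let ?\<pi> = "\<lambda>f. ext3_kernel S P +>\<^bsub>F\<^esub> f"
  have \<pi>: "?\<pi> \<in> mod_hom S F (ext3 S P)"
    unfolding ext3_def using F.module_axioms ext3_kernel_submodule by (rule quot_module_proj_hom)
  note \<pi>_simps = mod_homD[OF \<pi>]
  obtain f where f: "f \<in> carrier F" "y = ?\<pi> f"
    using assms(1) by (auto simp: ext3_def quot_module_carrier)
  have "Q (?\<pi> f)"
    using P.is_cring f(1)
  proof (induction rule: free_module_induct)
    case zero
    show ?case
      using assms(2) mod_hom_zero[OF F.module_axioms ext3_module \<pi>] by metis
  next
    case (add f g)
    then show ?case using assms(3) \<pi>_simps by metis
  next
    case (smult_gen a x)
    then obtain u v w where "x = (u, v, w)" "u \<in> carrier P" "v \<in> carrier P" "w \<in> carrier P"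
      by auto
    then show ?case
      using smult_gen(1) assms(4,5) wedge3_closed free_gen_triple_closed \<pi>_simps(3)
      by (simp add: wedge3_def)
  qed
  with f show ?thesis by simp
qed

text \<open>The linear extension of \<open>g\<close> to the free module kills every relator, hence the submodule that
  they generate, and so it descends to the quotient.\<close>

lemma ext3_universal:
  assumes "module S M" "alternating3 S P M g"
  obtains D where "D \<in> mod_hom S (ext3 S P) M" "D \<in> extensional (carrier (ext3 S P))"
    and "\<And>u v w. u \<in> carrier P \<Longrightarrow> v \<in> carrier P \<Longrightarrow> w \<in> carrier P \<Longrightarrow>
           D (wedge3 S P u v w) = g u v w"
proof -
  interpret M: module S M by fact
  let ?g = "\<lambda>(u, v, w). g u v w"
  let ?L = "linear_ext M ?g S"
  have g: "?g x \<in> carrier M" if "x \<in> triples P" for x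
    using that alternating3_closed[OF assms(2)] by auto
  have L: "?L \<in> mod_hom S F M"
    using assms(1) g by (rule linear_ext_hom)
  have gen: "?L (free_gen S (u, v, w)) = g u v w"
    if "u \<in> carrier P" "v \<in> carrier P" "w \<in> carrier P" for u v w
    using that g[of "(u, v, w)"] linear_ext_gen[OF assms(1), of ?g "(u, v, w)"] by simp
  have slot: "(\<lambda>w. g w u v) \<in> mod_hom S P M" "(\<lambda>w. g u w v) \<in> mod_hom S P M"
    "(\<lambda>w. g u v w) \<in> mod_hom S P M" "g u u v = \<zero>\<^bsub>M\<^esub>" "g u v u = \<zero>\<^bsub>M\<^esub>" "g v u u = \<zero>\<^bsub>M\<^esub>"
    if "u \<in> carrier P" "v \<in> carrier P" for u v
    using assms(2) that by (auto simp: alternating3_def)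
  have cancel: "x \<ominus>\<^bsub>M\<^esub> x = \<zero>\<^bsub>M\<^esub>" if "x \<in> carrier M" for x
    using that by (simp add: M.minus_eq M.r_neg)
  note simps = mod_hom_minus[OF F.module_axioms assms(1) L] mod_homD[OF L] gen
    free_gen_triple_closed mod_homD[OF slot(1)] mod_homD[OF slot(2)] mod_homD[OF slot(3)] cancel
    slot(4-6)
  have "ext3_relators S P \<subseteq> {x \<in> carrier F. ?L x = \<zero>\<^bsub>M\<^esub>}"
    unfolding ext3_relators_def Let_def by (auto simp: simps)
  then have "ext3_kernel S P \<subseteq> {x \<in> carrier F. ?L x = \<zero>\<^bsub>M\<^esub>}"
    unfolding ext3_kernel_def
    by (rule gen_submodule_least[OF mod_hom_kernel_submodule[OF F.module_axioms assms(1) L]])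
  then have "\<And>k. k \<in> ext3_kernel S P \<Longrightarrow> ?L k = \<zero>\<^bsub>M\<^esub>" by blast
  from quot_module_factor[OF F.module_axioms assms(1) ext3_kernel_submodule L this]
  obtain D where D: "D \<in> mod_hom S (ext3 S P) M" "D \<in> extensional (carrier (ext3 S P))"
    "\<And>x. x \<in> carrier F \<Longrightarrow> D (ext3_kernel S P +>\<^bsub>F\<^esub> x) = ?L x"
    unfolding ext3_def by blast
  have "D (wedge3 S P u v w) = g u v w"
    if "u \<in> carrier P" "v \<in> carrier P" "w \<in> carrier P" for u v w
    using that D(3) gen free_gen_triple_closed by (simp add: wedge3_def)
  with D that show ?thesis by blast
qed

lemma ext3_hom_eqI:
  assumes "module S M" "D \<in> mod_hom S (ext3 S P) M" "E \<in> mod_hom S (ext3 S P) M"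
    and "\<And>u v w. u \<in> carrier P \<Longrightarrow> v \<in> carrier P \<Longrightarrow> w \<in> carrier P \<Longrightarrow>
           D (wedge3 S P u v w) = E (wedge3 S P u v w)"
    and "x \<in> carrier (ext3 S P)"
  shows "D x = E x"
  using assms(5)
proof (induction rule: ext3_induct)
  case zero
  show ?case
    using mod_hom_zero[OF ext3_module assms(1) assms(2)] mod_hom_zero[OF ext3_module assms(1) assms(3)]
    by simp
qed (use assms(4) mod_homD[OF assms(2)] mod_homD[OF assms(3)] in auto)

end

text \<open>The map \<open>\<phi> u \<and> \<phi> v \<and> \<phi> w\<close> is alternating and trilinear in \<open>u, v, w\<close>, so the universal property
  gives existence; uniqueness holds because decomposable elements span. Together they turn the
  definite description of \<^const>\<open>ext3_map\<close> into its two characteristic properties.\<close>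

lemma ext3_map:
  assumes "module S P" "module S Q" "\<phi> \<in> mod_hom S P Q"
  shows "ext3_map S P Q \<phi> \<in> mod_hom S (ext3 S P) (ext3 S Q)"
    and "\<And>u v w. u \<in> carrier P \<Longrightarrow> v \<in> carrier P \<Longrightarrow> w \<in> carrier P \<Longrightarrow>
           ext3_map S P Q \<phi> (wedge3 S P u v w) = wedge3 S Q (\<phi> u) (\<phi> v) (\<phi> w)"
proof -
  have Q: "module S (ext3 S Q)" using assms(2) by (rule ext3_module)
  have alt: "alternating3 S P (ext3 S Q) (\<lambda>u v w. wedge3 S Q (\<phi> u) (\<phi> v) (\<phi> w))"
    using wedge3_alternating[OF assms(2)] assms(3) by (rule alternating3_comp)
  let ?spec = "\<lambda>D. D \<in> mod_hom S (ext3 S P) (ext3 S Q) \<and>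
     D \<in> extensional (carrier (ext3 S P)) \<and>
     (\<forall>u\<in>carrier P. \<forall>v\<in>carrier P. \<forall>w\<in>carrier P.
        D (wedge3 S P u v w) = wedge3 S Q (\<phi> u) (\<phi> v) (\<phi> w))"
  obtain D where D: "?spec D"
    using ext3_universal[OF assms(1) Q alt] by metis
  have "\<exists>!D. ?spec D"
  proof (rule ex1I[of ?spec, OF D])
    fix E assume E: "?spec E"
    show "E = D"
    proof (rule extensionalityI)
      show "E x = D x" if "x \<in> carrier (ext3 S P)" for x
        by (rule ext3_hom_eqI[OF assms(1) Q _ _ _ that]) (use D E in auto)
    qed (use D E in auto)
  qed
  then have "?spec (ext3_map S P Q \<phi>)"
    unfolding ext3_map_def by (rule theI')
  then show "ext3_map S P Q \<phi> \<in> mod_hom S (ext3 S P) (ext3 S Q)"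
    and "\<And>u v w. u \<in> carrier P \<Longrightarrow> v \<in> carrier P \<Longrightarrow> w \<in> carrier P \<Longrightarrow>
           ext3_map S P Q \<phi> (wedge3 S P u v w) = wedge3 S Q (\<phi> u) (\<phi> v) (\<phi> w)"
    by blast+
qed

section \<open>Hermitian spaces with trivial determinant\<close>

text \<open>The involution is built from the trace, itself a definite description. That the trace of \<open>s\<close> lies in
  \<open>R\<close> can be read off from the trace form at \<open>(1, s)\<close>, since that form takes \<open>S\<close> into its
  dual.\<close>

lemma canon_invol_closed:
  assumes "quadratic_etale R S" "s \<in> carrier S"
  shows "canon_invol R S s \<in> carrier S"
proof -
  interpret algebra R S using assms(1) by (simp add: quadratic_etale_def)
  have one: "\<one>\<^bsub>S\<^esub> \<in> carrier S" using M_cring by (rule cring.cring_simprules(6))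
  let ?form = "\<lambda>x. \<lambda>y\<in>carrier S. alg_trace R S (x \<otimes>\<^bsub>S\<^esub> y)"
  have "?form \<one>\<^bsub>S\<^esub> \<in> dual_carrier R S"
    using assms(1) one unfolding quadratic_etale_def by (meson bij_betw_apply)
  then have "?form \<one>\<^bsub>S\<^esub> s \<in> carrier R"
    using assms(2) unfolding dual_carrier_def by (auto dest: mod_homD(1) simp: self_module_def)
  then have "alg_trace R S s \<in> carrier R"
    using assms(2) M_cring by (simp add: cring.cring_simprules(12))
  then show ?thesis
    using assms(2) one by (simp add: canon_invol_def)
qed

lemma nondegenerate_represents:
  assumes "module S P" "nondegenerate S P h" "f \<in> mod_hom S P (self_module S)"
  shows "\<exists>!x. x \<in> carrier P \<and> (\<forall>u\<in>carrier P. h u x = f u)"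
proof -
  interpret P: module S P by fact
  let ?h = "\<lambda>w. \<lambda>u\<in>carrier P. h u w"
  have bij: "bij_betw ?h (carrier P) (dual_carrier S P)"
    using assms(2) by (simp add: nondegenerate_def)
  have "restrict f (carrier P) \<in> dual_carrier S P"
    unfolding dual_carrier_def using mod_homD[OF assms(3)] by (intro IntI mod_homI) auto
  then obtain x where x: "x \<in> carrier P" "?h x = restrict f (carrier P)"
    unfolding bij_betw_imp_surj_on[OF bij, symmetric] by force
  have "h u x = f u" if "u \<in> carrier P" for u
    using fun_cong[OF x(2), of u] that by simp
  moreover have "y = x" if "y \<in> carrier P" "\<forall>u\<in>carrier P. h u y = f u" for y
  proof -
    have "?h y = ?h x" unfolding x(2) using that(2) by (intro restrict_ext) auto
    then show ?thesis using bij_betw_imp_inj_on[OF bij] x(1) that(1) by (simp add: inj_onD)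
  qed
  ultimately show ?thesis using x(1) by blast
qed

text \<open>Used for rewriting, the symmetry law loops: its right-hand side contains an instance of its
  left-hand side. Keeping the laws apart leaves the other five usable as rewrite rules.\<close>

lemma hermitian_formD:
  assumes "hermitian_form R S P h"
  shows "u \<in> carrier P \<Longrightarrow> v \<in> carrier P \<Longrightarrow> h u v \<in> carrier S"
    and "u \<in> carrier P \<Longrightarrow> v \<in> carrier P \<Longrightarrow> w \<in> carrier P \<Longrightarrow>
           h (u \<oplus>\<^bsub>P\<^esub> v) w = h u w \<oplus>\<^bsub>S\<^esub> h v w"
    and "u \<in> carrier P \<Longrightarrow> v \<in> carrier P \<Longrightarrow> w \<in> carrier P \<Longrightarrow>
           h u (v \<oplus>\<^bsub>P\<^esub> w) = h u v \<oplus>\<^bsub>S\<^esub> h u w"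
    and "s \<in> carrier S \<Longrightarrow> u \<in> carrier P \<Longrightarrow> v \<in> carrier P \<Longrightarrow> h (s \<odot>\<^bsub>P\<^esub> u) v = s \<otimes>\<^bsub>S\<^esub> h u v"
    and "s \<in> carrier S \<Longrightarrow> u \<in> carrier P \<Longrightarrow> v \<in> carrier P \<Longrightarrow>
           h u (s \<odot>\<^bsub>P\<^esub> v) = canon_invol R S s \<otimes>\<^bsub>S\<^esub> h u v"
    and "u \<in> carrier P \<Longrightarrow> v \<in> carrier P \<Longrightarrow> h u v = canon_invol R S (h v u)"
  using assms unfolding hermitian_form_def by blast+

lemma hermitian_form_hom:
  assumes "hermitian_form R S P h" "v \<in> carrier P"
  shows "(\<lambda>u. h u v) \<in> mod_hom S P (self_module S)"
  using hermitian_formD(1,2,4)[OF assms(1)] assms(2)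
  by (intro mod_homI) (simp_all add: self_module_simps)

text \<open>A hermitian space together with a trivialization \<open>\<alpha>\<close> of its determinant and with the form \<open>H\<close> that
  \<open>h\<close> induces on the third exterior power. On decomposable elements \<open>H\<close> is a Gram determinant, and
  \<open>\<alpha>\<close> makes it the rank one form \<open>\<alpha> x \<sqdot> invol (\<alpha> y)\<close>; the interplay of these two
  descriptions drives the main argument.\<close>

locale trivialized_space = module S P
  for R :: "('a, 'k) ring_scheme" and S :: "('a, 'b, 'l) module_scheme"
    and P :: "('b, 'p, 'm) module_scheme" +
  fixes h :: "'p \<Rightarrow> 'p \<Rightarrow> 'b" and \<alpha> :: "('p \<times> 'p \<times> 'p \<Rightarrow> 'b) set \<Rightarrow> 'b"
    and H :: "('p \<times> 'p \<times> 'p \<Rightarrow> 'b) set \<Rightarrow> ('p \<times> 'p \<times> 'p \<Rightarrow> 'b) set \<Rightarrow> 'b"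
  assumes invol_closed: "s \<in> carrier S \<Longrightarrow> canon_invol R S s \<in> carrier S"
    and hermitian: "hermitian_form R S P h"
    and nondegenerate: "nondegenerate S P h"
    and ext3_form: "ext3_form R S P h H"
    and \<alpha>_iso: "\<alpha> \<in> hermitian_iso S (ext3 S P) H (self_module S) (unit_form R S)"
begin

abbreviation invol :: "'b \<Rightarrow> 'b" where "invol \<equiv> canon_invol R S"

abbreviation E :: "('b, ('p \<times> 'p \<times> 'p \<Rightarrow> 'b) set) module" where "E \<equiv> ext3 S P"

lemmas h_simps = hermitian_formD[OF hermitian]

lemma h_eqI:
  assumes "x \<in> carrier P" "y \<in> carrier P" "\<And>u. u \<in> carrier P \<Longrightarrow> h u x = h u y"
  shows "x = y"
  using nondegenerate_represents[OF module_axioms nondegenerate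
      hermitian_form_hom[OF hermitian assms(2)]] assms
  by blast

lemma hermitian_ext3: "hermitian_form R S E H"
  using ext3_form by (simp add: ext3_form_def)

lemmas H_simps = hermitian_formD[OF hermitian_ext3]

lemma H_wedge:
  assumes "{u0, u1, u2, v0, v1, v2} \<subseteq> carrier P"
  shows "H (wedge3 S P u0 u1 u2) (wedge3 S P v0 v1 v2) =
    det3 S (\<lambda>i j. h ([u0, u1, u2] ! i) ([v0, v1, v2] ! j))"
proof -
  have "{..<3::nat} = {0, 1, 2}" by auto
  then have "(!) [u0, u1, u2] ` {..<3} \<subseteq> carrier P" "(!) [v0, v1, v2] ` {..<3} \<subseteq> carrier P"
    using assms by auto
  moreover have "[a, b, c] ! 0 = a" "[a, b, c] ! 1 = b" "[a, b, c] ! 2 = c" for a b c :: 'p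
    by auto
  ultimately show ?thesis
    using ext3_form unfolding ext3_form_def by metis
qed

lemma \<alpha>_hom: "\<alpha> \<in> mod_hom S E (self_module S)"
  using \<alpha>_iso by (simp add: hermitian_iso_def mod_iso_def)

lemma \<alpha>_closed: "x \<in> carrier E \<Longrightarrow> \<alpha> x \<in> carrier S"
  using mod_homD(1)[OF \<alpha>_hom] by (simp add: self_module_def)

lemma H_eq: "x \<in> carrier E \<Longrightarrow> y \<in> carrier E \<Longrightarrow> H x y = \<alpha> x \<otimes>\<^bsub>S\<^esub> invol (\<alpha> y)"
  using \<alpha>_iso by (simp add: hermitian_iso_def unit_form_def)

text \<open>An element of volume one recovers the values of \<open>\<alpha>\<close>, up to the involution, from \<open>H\<close>.\<close>

lemma unit_volume:
  obtains x where "x \<in> carrier E" "\<alpha> x = \<one>\<^bsub>S\<^esub>"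
proof -
  have "bij_betw \<alpha> (carrier E) (carrier S)"
    using \<alpha>_iso by (simp add: hermitian_iso_def mod_iso_def self_module_def)
  then have "\<one>\<^bsub>S\<^esub> \<in> \<alpha> ` carrier E" by (simp add: bij_betw_def)
  then show ?thesis using that by auto
qed

text \<open>Since \<open>\<alpha> x = 1\<close>, the factor \<open>H x x\<close> is the conjugate of \<open>1\<close>. Computing \<open>H x (s x)\<close> once
  by semilinearity and once through \<open>\<alpha>\<close> shows that this factor can be absorbed into any conjugate.\<close>

lemma invol_one_right:
  assumes "s \<in> carrier S" "x \<in> carrier E" "\<alpha> x = \<one>\<^bsub>S\<^esub>"
  shows "invol s \<otimes>\<^bsub>S\<^esub> H x x = invol s"
proof -
  interpret E: module S E by (rule ext3_module) (rule module_axioms)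
  have sx: "s \<odot>\<^bsub>E\<^esub> x \<in> carrier E" using assms by simp
  have "\<alpha> (s \<odot>\<^bsub>E\<^esub> x) = s"
    using mod_homD(3)[OF \<alpha>_hom] assms by (simp add: self_module_def)
  then have "H x (s \<odot>\<^bsub>E\<^esub> x) = invol s"
    using H_eq[OF assms(2) sx] assms invol_closed by simp
  moreover have "H x (s \<odot>\<^bsub>E\<^esub> x) = invol s \<otimes>\<^bsub>S\<^esub> H x x"
    using assms(1,2) by (simp add: H_simps(5))
  ultimately show ?thesis by simp
qed

text \<open>The form \<open>u \<mapsto> \<alpha> (u \<and> v \<and> w)\<close> is linear, so nondegeneracy represents it by a unique vector.\<close>

lemma cross_represents:
  assumes "v \<in> carrier P" "w \<in> carrier P"
  shows "cross S P h \<alpha> v w \<in> carrier P"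
    and "u \<in> carrier P \<Longrightarrow> h u (cross S P h \<alpha> v w) = \<alpha> (wedge3 S P u v w)"
proof -
  have "(\<lambda>u. wedge3 S P u v w) \<in> mod_hom S P E"
    using wedge3_alternating[OF module_axioms] assms by (simp add: alternating3_def)
  from nondegenerate_represents[OF module_axioms nondegenerate mod_hom_comp[OF this \<alpha>_hom]]
  show "cross S P h \<alpha> v w \<in> carrier P"
    and "u \<in> carrier P \<Longrightarrow> h u (cross S P h \<alpha> v w) = \<alpha> (wedge3 S P u v w)"
    unfolding cross_def by (auto dest!: theI')
qed

end

section \<open>Volume preserving isometries are bijective\<close>

text \<open>Expansion along the first row: \<open>t\<close> kills the three minors of the last two rows, hence the
  determinant.\<close>

lemma (in cring) scaled_det3_zero:
  assumes "t \<in> carrier R" "\<And>i j. i < 3 \<Longrightarrow> j < 3 \<Longrightarrow> m i j \<in> carrier R"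
    and "t \<otimes> (m 1 1 \<otimes> m 2 2) = t \<otimes> (m 1 2 \<otimes> m 2 1)"
    and "t \<otimes> (m 1 2 \<otimes> m 2 0) = t \<otimes> (m 1 0 \<otimes> m 2 2)"
    and "t \<otimes> (m 1 0 \<otimes> m 2 1) = t \<otimes> (m 1 1 \<otimes> m 2 0)"
  shows "t \<otimes> det3 R m = \<zero>"
proof -
  have closed: "m 0 0 \<in> carrier R" "m 0 1 \<in> carrier R" "m 0 2 \<in> carrier R"
    "m 1 0 \<in> carrier R" "m 1 1 \<in> carrier R" "m 1 2 \<in> carrier R"
    "m 2 0 \<in> carrier R" "m 2 1 \<in> carrier R" "m 2 2 \<in> carrier R"
    using assms(2) by auto
  have swap: "t \<otimes> (x \<otimes> y \<otimes> z) = t \<otimes> (x' \<otimes> y' \<otimes> z')"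
    if "t \<otimes> (y \<otimes> z) = t \<otimes> (y' \<otimes> z')" "x = x'"
      "x \<in> carrier R" "y \<in> carrier R" "z \<in> carrier R" "y' \<in> carrier R" "z' \<in> carrier R"
    for x x' y y' z z'
  proof -
    have "t \<otimes> (x \<otimes> y \<otimes> z) = x \<otimes> (t \<otimes> (y \<otimes> z))"
      using assms(1) that(3-5) by (simp add: m_ac)
    also have "\<dots> = x \<otimes> (t \<otimes> (y' \<otimes> z'))" using that(1) by simp
    also have "\<dots> = t \<otimes> (x \<otimes> y' \<otimes> z')" using assms(1) that(3,6,7) by (simp add: m_ac)
    finally show ?thesis using that(2) by simp
  qed
  let ?p = "t \<otimes> (m 0 0 \<otimes> m 1 1 \<otimes> m 2 2)" and ?q = "t \<otimes> (m 0 1 \<otimes> m 1 2 \<otimes> m 2 0)"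
    and ?r = "t \<otimes> (m 0 2 \<otimes> m 1 0 \<otimes> m 2 1)"
  have "t \<otimes> det3 R m = (?p \<oplus> ?q \<oplus> ?r) \<ominus> (t \<otimes> (m 0 2 \<otimes> m 1 1 \<otimes> m 2 0) \<oplus>
      t \<otimes> (m 0 1 \<otimes> m 1 0 \<otimes> m 2 2) \<oplus> t \<otimes> (m 0 0 \<otimes> m 1 2 \<otimes> m 2 1))"
    unfolding det3_def minus_eq using assms(1) closed by (simp only: r_distr r_minus m_closed
      a_closed a_inv_closed)
  also have "\<dots> = (?p \<oplus> ?q \<oplus> ?r) \<ominus> (?r \<oplus> ?q \<oplus> ?p)"
    using swap[OF assms(3) refl, of "m 0 0"] swap[OF assms(4) refl, of "m 0 1"]
      swap[OF assms(5) refl, of "m 0 2"] closed by simp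
  also have "?r \<oplus> ?q \<oplus> ?p = ?p \<oplus> ?q \<oplus> ?r"
    using assms(1) closed by (simp only: a_ac m_closed a_closed)
  also have "(?p \<oplus> ?q \<oplus> ?r) \<ominus> (?p \<oplus> ?q \<oplus> ?r) = \<zero>"
    using assms(1) closed by (simp only: minus_eq r_neg m_closed a_closed)
  finally show ?thesis .
qed

locale trivialized_isometry =
  dom: trivialized_space R S P h \<alpha> H + cod: trivialized_space R S P' h' \<alpha>' H'
  for R :: "('a, 'k) ring_scheme" and S :: "('a, 'b, 'l) module_scheme"
    and P :: "('b, 'p, 'm) module_scheme" and h \<alpha> H
    and P' :: "('b, 'q, 'n) module_scheme" and h' \<alpha>' H' +
  fixes \<phi> :: "'p \<Rightarrow> 'q"
  assumes \<phi>_hom: "\<phi> \<in> mod_hom S P P'"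
    and volume: "x \<in> carrier (ext3 S P) \<Longrightarrow> \<alpha>' (ext3_map S P P' \<phi> x) = \<alpha> x"
    and isometry: "u \<in> carrier P \<Longrightarrow> v \<in> carrier P \<Longrightarrow> h' (\<phi> u) (\<phi> v) = h u v"
begin

lemmas \<phi>_simps = mod_homD[OF \<phi>_hom]

lemmas ext3_map_simps = ext3_map[OF dom.module_axioms cod.module_axioms \<phi>_hom]

lemma inj_on_carrier: "inj_on \<phi> (carrier P)"
proof (rule inj_onI)
  fix u v assume "u \<in> carrier P" "v \<in> carrier P" "\<phi> u = \<phi> v"
  then show "u = v" using isometry by (intro dom.h_eqI) metis+
qed

lemma zero_map_hom: "(\<lambda>x. \<zero>\<^bsub>S\<^esub>) \<in> mod_hom S (ext3 S P) (self_module S)"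
  by (rule mod_homI) (auto simp: self_module_def)

text \<open>Let \<open>q\<close> be orthogonal to the image of \<open>\<phi>\<close>. The Gram determinant of any triple from the image against
  \<open>q, \<phi> b', \<phi> c'\<close> has a zero column. Some linear combination of the wedges of such triples has
  volume one, so \<open>q \<and> \<phi> b' \<and> \<phi> c'\<close> has a volume with zero conjugate and is orthogonal to the whole exterior
  power, in particular to \<open>q' \<and> \<phi> b \<and> \<phi> c\<close>. In that last Gram determinant the first column is
  \<open>(h' q' q, 0, 0)\<close>, and expanding along it gives the claim.\<close>

lemma orthogonal_annihilates_minors:
  assumes q: "q \<in> carrier P'" "\<And>u. u \<in> carrier P \<Longrightarrow> h' (\<phi> u) q = \<zero>\<^bsub>S\<^esub>"
    and q': "q' \<in> carrier P'"
    and b: "b \<in> carrier P" "c \<in> carrier P" "b' \<in> carrier P" "c' \<in> carrier P"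
  shows "h' q' q \<otimes>\<^bsub>S\<^esub> (h b b' \<otimes>\<^bsub>S\<^esub> h c c') = h' q' q \<otimes>\<^bsub>S\<^esub> (h b c' \<otimes>\<^bsub>S\<^esub> h c b')"
proof -
  let ?D = "ext3_map S P P' \<phi>" and ?y = "wedge3 S P' q (\<phi> b') (\<phi> c')"
    and ?z = "wedge3 S P' q' (\<phi> b) (\<phi> c)"
  have y: "?y \<in> carrier (ext3 S P')" and z: "?z \<in> carrier (ext3 S P')"
    using q(1) q' b \<phi>_simps(1) wedge3_closed[OF cod.module_axioms] by auto
  \<comment> \<open>A whole column of the Gram matrix is zero here, the one that belongs to \<open>q\<close>.\<close>
  have image: "H' (?D x) ?y = \<zero>\<^bsub>S\<^esub>" if x: "x \<in> carrier (ext3 S P)" for x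
  proof (rule ext3_hom_eqI[OF dom.module_axioms self_module_module _ zero_map_hom _ x])
    show "cring S" by (rule dom.is_cring)
    show "(\<lambda>x. H' (?D x) ?y) \<in> mod_hom S (ext3 S P) (self_module S)"
      using ext3_map_simps(1) hermitian_form_hom[OF cod.hermitian_ext3 y] by (rule mod_hom_comp)
    fix u v w assume u: "u \<in> carrier P" "v \<in> carrier P" "w \<in> carrier P"
    then show "H' (?D (wedge3 S P u v w)) ?y = \<zero>\<^bsub>S\<^esub>"
      using q b \<phi>_simps(1)
      by (simp add: ext3_map_simps(2) cod.H_wedge det3_def cod.h_simps(1) dom.R.minus_zero_right)
  qed
  obtain x where x: "x \<in> carrier (ext3 S P)" "\<alpha> x = \<one>\<^bsub>S\<^esub>" by (rule dom.unit_volume)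
  have "dom.invol (\<alpha>' ?y) = H' (?D x) ?y"
    using x y mod_homD(1)[OF ext3_map_simps(1)]
    by (simp add: cod.H_eq volume cod.invol_closed cod.\<alpha>_closed)
  then have "H' ?z ?y = \<zero>\<^bsub>S\<^esub>"
    using x z y image by (simp add: cod.H_eq cod.\<alpha>_closed)
  then have "h' q' q \<otimes>\<^bsub>S\<^esub> h b b' \<otimes>\<^bsub>S\<^esub> h c c' \<ominus>\<^bsub>S\<^esub> h' q' q \<otimes>\<^bsub>S\<^esub> h b c' \<otimes>\<^bsub>S\<^esub> h c b' = \<zero>\<^bsub>S\<^esub>"
    using q q' b \<phi>_simps(1)
    by (simp add: cod.H_wedge det3_def cod.h_simps(1) dom.h_simps(1) isometry)
  then show ?thesis
    using q q' b
    by - (rule dom.R.minus_eq_zeroD, simp_all add: cod.h_simps(1) dom.h_simps(1) dom.m_assoc)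
qed

text \<open>The scalar \<open>t = h' q' q\<close> kills all two by two Gram minors of \<open>P\<close>, hence all three by three Gram
  determinants, hence all values of the form \<open>H\<close>. These include the norm of an element of
  volume one, which is the conjugate of \<open>1\<close>; as \<open>t\<close> is itself a conjugate, it vanishes. Since \<open>q'\<close> is
  arbitrary, nondegeneracy gives \<open>q = 0\<close>.\<close>

lemma orthogonal_zero:
  assumes q: "q \<in> carrier P'" "\<And>u. u \<in> carrier P \<Longrightarrow> h' (\<phi> u) q = \<zero>\<^bsub>S\<^esub>"
  shows "q = \<zero>\<^bsub>P'\<^esub>"
proof (rule cod.h_eqI)
  fix q' assume q': "q' \<in> carrier P'"
  interpret E: module S "ext3 S P" by (rule ext3_module) (rule dom.module_axioms)
  let ?t = "h' q' q"
  have t: "?t \<in> carrier S" using q(1) q' by (rule cod.h_simps(1)[rotated])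
  note minors = orthogonal_annihilates_minors[OF q q']
  have H_closed: "H x y \<in> carrier S" if "x \<in> carrier (ext3 S P)" "y \<in> carrier (ext3 S P)" for x y
    using that by (rule dom.H_simps(1))
  have wedges: "?t \<otimes>\<^bsub>S\<^esub> H (wedge3 S P u0 u1 u2) (wedge3 S P v0 v1 v2) = \<zero>\<^bsub>S\<^esub>"
    if "{u0, u1, u2, v0, v1, v2} \<subseteq> carrier P" for u0 u1 u2 v0 v1 v2
    unfolding dom.H_wedge[OF that]
  proof (rule dom.R.scaled_det3_zero[OF t])
    fix i j :: nat assume "i < 3" "j < 3"
    then have "[u0, u1, u2] ! i \<in> carrier P" "[v0, v1, v2] ! j \<in> carrier P"
      using that by (auto simp: less_Suc_eq numeral_3_eq_3)
    then show "h ([u0, u1, u2] ! i) ([v0, v1, v2] ! j) \<in> carrier S" by (rule dom.h_simps(1))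
  qed (use that in \<open>simp_all, auto intro!: minors\<close>)
  have scaled_hom: "(\<lambda>x. ?t \<otimes>\<^bsub>S\<^esub> H x y) \<in> mod_hom S (ext3 S P) (self_module S)"
    if y: "y \<in> carrier (ext3 S P)" for y
    by (rule mod_homI)
      (use t y H_closed in \<open>simp_all add: self_module_simps dom.H_simps(2,4) dom.R.r_distr
         dom.m_lcomm\<close>)
  have all: "?t \<otimes>\<^bsub>S\<^esub> H x y = \<zero>\<^bsub>S\<^esub>"
    if x: "x \<in> carrier (ext3 S P)" and y: "y \<in> carrier (ext3 S P)" for x y
    using y
  proof (induction rule: ext3_induct[OF dom.module_axioms, consumes 1, case_names zero add smult wedge])
    case zero
    have "H x \<zero>\<^bsub>ext3 S P\<^esub> = \<zero>\<^bsub>S\<^esub>"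
      using dom.H_simps(3)[OF x E.zero_closed E.zero_closed] H_closed[OF x E.M.zero_closed]
      by simp
    then show ?case using t by simp
  next
    case (add y z)
    then show ?case
      using t x by (simp add: dom.H_simps(3) dom.R.r_distr H_closed)
  next
    case (smult a y)
    have "?t \<otimes>\<^bsub>S\<^esub> H x (a \<odot>\<^bsub>ext3 S P\<^esub> y) = dom.invol a \<otimes>\<^bsub>S\<^esub> (?t \<otimes>\<^bsub>S\<^esub> H x y)"
      using smult.hyps t x by (simp add: dom.H_simps(5) dom.m_lcomm H_closed dom.invol_closed)
    also have "\<dots> = \<zero>\<^bsub>S\<^esub>" using smult by (simp add: dom.invol_closed)
    finally show ?case .
  next
    case (wedge v0 v1 v2)
    show ?case
    proof (rule ext3_hom_eqI[OF dom.module_axioms self_module_module scaled_hom zero_map_hom _ x])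
      show "cring S" by (rule dom.is_cring)
      show "wedge3 S P v0 v1 v2 \<in> carrier (ext3 S P)"
        using wedge by (rule wedge3_closed[OF dom.module_axioms])
    qed (use wedge wedges in auto)
  qed
  obtain x where x: "x \<in> carrier (ext3 S P)" "\<alpha> x = \<one>\<^bsub>S\<^esub>" by (rule dom.unit_volume)
  have "?t = dom.invol (h' q q')" using q' q(1) by (rule cod.h_simps(6))
  also have "\<dots> = dom.invol (h' q q') \<otimes>\<^bsub>S\<^esub> H x x"
    using cod.h_simps(1)[OF q(1) q'] x by (rule dom.invol_one_right[symmetric])
  also have "\<dots> = ?t \<otimes>\<^bsub>S\<^esub> H x x" using q' q(1) cod.h_simps(6) by metis
  also have "\<dots> = \<zero>\<^bsub>S\<^esub>" using x(1) x(1) by (rule all)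
  also have "\<dots> = h' q' \<zero>\<^bsub>P'\<^esub>"
    using cod.h_simps(3)[OF q' cod.M.zero_closed cod.M.zero_closed]
      cod.h_simps(1)[OF q' cod.M.zero_closed] by simp
  finally show "?t = h' q' \<zero>\<^bsub>P'\<^esub>" .
qed (use q in auto)

text \<open>Orthogonal projection: the form \<open>u \<mapsto> h' (\<phi> u) p\<close> on \<open>P\<close> is represented by some \<open>w\<close>, and then
  \<open>p - \<phi> w\<close> is orthogonal to the image of \<open>\<phi>\<close>.\<close>

lemma image_carrier: "\<phi> ` carrier P = carrier P'"
proof
  show "\<phi> ` carrier P \<subseteq> carrier P'" using \<phi>_simps(1) by auto
next
  show "carrier P' \<subseteq> \<phi> ` carrier P"
  proof
    fix p assume p: "p \<in> carrier P'"
    obtain w where w: "w \<in> carrier P" "\<And>u. u \<in> carrier P \<Longrightarrow> h u w = h' (\<phi> u) p"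
      using nondegenerate_represents[OF dom.module_axioms dom.nondegenerate
          mod_hom_comp[OF \<phi>_hom hermitian_form_hom[OF cod.hermitian p]]]
      by blast
    let ?q = "p \<ominus>\<^bsub>P'\<^esub> \<phi> w"
    have q: "?q \<in> carrier P'" using p w(1) \<phi>_simps(1) by simp
    have split: "p = ?q \<oplus>\<^bsub>P'\<^esub> \<phi> w"
      using p w(1) \<phi>_simps(1) by (simp add: cod.M.minus_eq cod.M.a_assoc cod.M.l_neg)
    have "h' (\<phi> u) ?q = \<zero>\<^bsub>S\<^esub>" if u: "u \<in> carrier P" for u
    proof -
      have "h' (\<phi> u) p = h' (\<phi> u) ?q \<oplus>\<^bsub>S\<^esub> h' (\<phi> u) (\<phi> w)"
        using cod.h_simps(3)[of "\<phi> u" ?q "\<phi> w"] q u w(1) \<phi>_simps(1) split by simp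
      moreover have "h' (\<phi> u) p = h' (\<phi> u) (\<phi> w)"
        using u w isometry by simp
      ultimately show ?thesis
        using cod.h_simps(1)[of "\<phi> u" ?q] cod.h_simps(1)[of "\<phi> u" "\<phi> w"] q u w(1) \<phi>_simps(1)
        by (metis dom.R.add.r_cancel_one')
    qed
    then have "?q = \<zero>\<^bsub>P'\<^esub>" using q by (intro orthogonal_zero)
    then have "p = \<phi> w" using split w(1) \<phi>_simps(1) by simp
    then show "p \<in> \<phi> ` carrier P" using w(1) by blast
  qed
qed

lemma bij_betw_carriers: "bij_betw \<phi> (carrier P) (carrier P')"
  using inj_on_carrier image_carrier by (simp add: bij_betw_def)

text \<open>Both sides have the same product with every \<open>\<phi> w\<close>, namely the volume of \<open>w \<and> u \<and> v\<close>; as \<open>\<phi>\<close> is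
  onto, nondegeneracy separates vectors by such products.\<close>

lemma map_cross:
  assumes "u \<in> carrier P" "v \<in> carrier P"
  shows "\<phi> (cross S P h \<alpha> u v) = cross S P' h' \<alpha>' (\<phi> u) (\<phi> v)"
proof (rule cod.h_eqI)
  show "\<phi> (cross S P h \<alpha> u v) \<in> carrier P'" "cross S P' h' \<alpha>' (\<phi> u) (\<phi> v) \<in> carrier P'"
    using assms by (simp_all add: \<phi>_simps(1) dom.cross_represents cod.cross_represents)
  fix w' assume "w' \<in> carrier P'"
  then obtain w where w: "w \<in> carrier P" "w' = \<phi> w" using image_carrier by blast
  have "h' w' (\<phi> (cross S P h \<alpha> u v)) = \<alpha> (wedge3 S P w u v)"
    using assms w by (simp add: isometry dom.cross_represents)
  also have "\<dots> = \<alpha>' (ext3_map S P P' \<phi> (wedge3 S P w u v))"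
    using assms w by (simp add: volume wedge3_closed[OF dom.module_axioms])
  also have "\<dots> = h' w' (cross S P' h' \<alpha>' (\<phi> u) (\<phi> v))"
    using assms w by (simp add: ext3_map_simps(2) cod.cross_represents \<phi>_simps(1))
  finally show "h' w' (\<phi> (cross S P h \<alpha> u v)) = h' w' (cross S P' h' \<alpha>' (\<phi> u) (\<phi> v))" .
qed

end

section \<open>The isomorphisms\<close>

context trivialized_isometry
begin

lemma base_smult_compat:
  assumes "algebra R S" "r \<in> carrier R" "u \<in> carrier P"
  shows "base_smult S P r u \<in> carrier P" and "\<phi> (base_smult S P r u) = base_smult S P' r (\<phi> u)"
proof -
  interpret algebra R S by fact
  have "\<one>\<^bsub>S\<^esub> \<in> carrier S" using M_cring by (rule cring.cring_simprules(6))
  then have "r \<odot>\<^bsub>S\<^esub> \<one>\<^bsub>S\<^esub> \<in> carrier S" using assms(2) by simp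
  then show "base_smult S P r u \<in> carrier P"
    "\<phi> (base_smult S P r u) = base_smult S P' r (\<phi> u)"
    using assms(3) by (simp_all add: base_smult_def \<phi>_simps(3))
qed

lemma pair_bij: "bij_betw (\<lambda>(a, u). (a, \<phi> u)) (A \<times> carrier P) (A \<times> carrier P')"
  using bij_betw_map_prod[OF bij_betw_id bij_betw_carriers, of A] by (simp add: map_prod_def)

lemma vector_colour_alg_iso:
  assumes "algebra R S"
  shows "\<phi> \<in> alg_iso R (vector_colour_alg S P h \<alpha>) (vector_colour_alg S P' h' \<alpha>')"
  using bij_betw_carriers
  by (auto simp: alg_iso_def mod_iso_def vector_colour_alg_def map_cross base_smult_compat[OF assms]
      \<phi>_simps intro!: mod_homI)

lemma colour_alg_iso:
  assumes "algebra R S"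
  shows "(\<lambda>(a, u). (a, \<phi> u)) \<in> alg_iso R (colour_alg R S P h \<alpha>) (colour_alg R S P' h' \<alpha>')"
proof -
  interpret algebra R S by fact
  show ?thesis
    using pair_bij[of "carrier R"]
    by (auto simp: alg_iso_def mod_iso_def colour_alg_def map_cross base_smult_compat[OF assms] \<phi>_simps
        isometry dom.cross_represents(1) intro!: mod_homI)
qed

lemma octonion_alg_iso:
  assumes "algebra R S"
  shows "(\<lambda>(a, u). (a, \<phi> u)) \<in> alg_iso R (octonion_alg R S P h \<alpha>) (octonion_alg R S P' h' \<alpha>')"
proof -
  interpret algebra R S by fact
  show ?thesis
    using pair_bij[of "carrier S"]
    by (auto simp: alg_iso_def mod_iso_def octonion_alg_def map_cross base_smult_compat[OF assms] \<phi>_simps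
        isometry dom.cross_represents(1) dom.invol_closed intro!: mod_homI)
qed

end

lemma hermitian_space3_trivialized:
  assumes "quadratic_etale R S" "hermitian_space3 R S P h" "det_trivialization R S P h \<alpha>"
  obtains H where "trivialized_space R S P h \<alpha> H"
proof -
  from assms(3) obtain H where "ext3_form R S P h H"
    "\<alpha> \<in> hermitian_iso S (ext3 S P) H (self_module S) (unit_form R S)"
    by (auto simp: det_trivialization_def)
  moreover have "module S P" "hermitian_form R S P h" "nondegenerate S P h"
    using assms(2) by (simp_all add: hermitian_space3_def fg_projective_def)
  ultimately have "trivialized_space R S P h \<alpha> H"
    using canon_invol_closed[OF assms(1)]
    by (simp add: trivialized_space_def trivialized_space_axioms_def)
  then show ?thesis by (rule that)
qed

theorem proposition3p2:
  fixes R :: "'r ring" and S :: "('r, 's) module"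
    and P :: "('s, 'p) module" and P' :: "('s, 'q) module"
    and h :: "'p \<Rightarrow> 'p \<Rightarrow> 's" and h' :: "'q \<Rightarrow> 'q \<Rightarrow> 's"
    and \<alpha> :: "('p \<times> 'p \<times> 'p \<Rightarrow> 's) set \<Rightarrow> 's" and \<alpha>' :: "('q \<times> 'q \<times> 'q \<Rightarrow> 's) set \<Rightarrow> 's"
    and \<phi> :: "'p \<Rightarrow> 'q"
  assumes "cring R" and "\<one>\<^bsub>R\<^esub> \<oplus>\<^bsub>R\<^esub> \<one>\<^bsub>R\<^esub> \<in> Units R"
    and "quadratic_etale R S"
    and "hermitian_space3 R S P h" and "hermitian_space3 R S P' h'"
    and "det_trivialization R S P h \<alpha>" and "det_trivialization R S P' h' \<alpha>'"
    and "\<phi> \<in> mod_hom S P P'"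
    and "\<forall>x\<in>carrier (ext3 S P). \<alpha>' (ext3_map S P P' \<phi> x) = \<alpha> x"
    and "\<forall>u\<in>carrier P. \<forall>v\<in>carrier P. h' (\<phi> u) (\<phi> v) = h u v"
  shows "(\<forall>u\<in>carrier P. \<forall>v\<in>carrier P.
            \<phi> (cross S P h \<alpha> u v) = cross S P' h' \<alpha>' (\<phi> u) (\<phi> v)) \<and>
         \<phi> \<in> alg_iso R (vector_colour_alg S P h \<alpha>) (vector_colour_alg S P' h' \<alpha>') \<and>
         (\<lambda>(a, u). (a, \<phi> u)) \<in> alg_iso R (colour_alg R S P h \<alpha>) (colour_alg R S P' h' \<alpha>') \<and>
         (\<lambda>(a, u). (a, \<phi> u)) \<in> alg_iso R (octonion_alg R S P h \<alpha>) (octonion_alg R S P' h' \<alpha>')"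
proof -
  obtain H where "trivialized_space R S P h \<alpha> H"
    using assms(3,4,6) by (rule hermitian_space3_trivialized)
  moreover obtain H' where "trivialized_space R S P' h' \<alpha>' H'"
    using assms(3,5,7) by (rule hermitian_space3_trivialized)
  ultimately interpret trivialized_isometry R S P h \<alpha> H P' h' \<alpha>' H' \<phi>
    using assms(8-10) by (simp add: trivialized_isometry_def trivialized_isometry_axioms_def)
  have "algebra R S" using assms(3) by (simp add: quadratic_etale_def)
  then show ?thesis
    using map_cross vector_colour_alg_iso colour_alg_iso octonion_alg_iso by blast
qed

end
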